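(* Let $k$ be an integer and let $G$ be a balanced bipartite graph with $|V(G)|=2n\ge\max\{6k(k+1),\,4(k+2)^2\}$ and $\delta(G)\ge k\ge 2$. If either $\rho(G)\ge\rho(F^0_{n,k,0})$ or $\mu(G)\ge\mu(F^0_{n,k,0})$, then $G$ is traceable unless $G\in\{F_{n,k,0},\,F^0_{n,k,0}\}$.
   Context: Graphs are finite, simple and undirected; equality of graphs is up to isomorphism. A bipartite graph with bipartition $(U,V)$ is balanced if $|U|=|V|$. $\delta(G)$ is the minimum degree, $\rho(G)$ is the largest eigenvalue of the adjacency matrix $A(G)$, and $\mu(G)$ is the largest eigenvalue of $A(G)+D(G)$, where $D(G)$ is the diagonal degree matrix. A graph is traceable if it contains a spanning path. For integers $n>k\ge 0$, $a\ge k+1$, $b\ge1$, let $(X,Y)$ be the bipartition of $K_{n,a+b}$ with $|X|=n$, $|Y|=a+b$, let $X_1\subset X$ with $|X_1|=n-k$ and $Y_1\subset Y$ with $|Y_1|=b$. Then $Z_{a,b}$ (depending also on $n,k$) is the graph obtained from $K_{n,a+b}$ by deleting all edges between $X_1$ and $Y_1$, and $Z^0_{a,b}=Z_{a,b}-e$, where $e=uv$ is an edge of $Z_{a,b}$ with $u\in Y\setminus Y_1$ (so $d(u)=n$) and $v\in X_1$ (so $d(v)=a$). Define $F_{n,k,0}=Z_{n-k-1,\,k+1}$ and $F^0_{n,k,0}=Z^0_{n-k-1,\,k+1}$. *)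

theory Defs
  imports "Jordan_Normal_Form.Spectral_Radius"
begin

record 'a sgraph =
  verts :: "'a set"
  edges :: "'a set set"

definition simple_graph :: "'a sgraph \<Rightarrow> bool" where
  "simple_graph G \<longleftrightarrow> finite (verts G) \<and>
     (\<forall>e\<in>edges G. \<exists>u v. u \<in> verts G \<and> v \<in> verts G \<and> u \<noteq> v \<and> e = {u, v})"

definition graph_iso :: "'a sgraph \<Rightarrow> 'b sgraph \<Rightarrow> bool" where
  "graph_iso G H \<longleftrightarrow> (\<exists>f. bij_betw f (verts G) (verts H) \<and>
     (\<forall>u\<in>verts G. \<forall>v\<in>verts G. {u, v} \<in> edges G \<longleftrightarrow> {f u, f v} \<in> edges H))"

definition bipartition :: "'a sgraph \<Rightarrow> 'a set \<Rightarrow> 'a set \<Rightarrow> bool" where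
  "bipartition G U W \<longleftrightarrow> U \<union> W = verts G \<and> U \<inter> W = {} \<and>
     (\<forall>e\<in>edges G. \<exists>u\<in>U. \<exists>w\<in>W. e = {u, w})"

definition balanced_bipartite :: "'a sgraph \<Rightarrow> bool" where
  "balanced_bipartite G \<longleftrightarrow> (\<exists>U W. bipartition G U W \<and> card U = card W)"

definition degree :: "'a sgraph \<Rightarrow> 'a \<Rightarrow> nat" where
  "degree G v = card {u \<in> verts G. {u, v} \<in> edges G}"

definition min_degree :: "'a sgraph \<Rightarrow> nat" where
  "min_degree G = Min (degree G ` verts G)"

definition traceable :: "'a sgraph \<Rightarrow> bool" where
  "traceable G \<longleftrightarrow> (\<exists>p. distinct p \<and> set p = verts G \<and>
     successively (\<lambda>u v. {u, v} \<in> edges G) p)"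

(* The matrices of a graph are taken with respect to a fixed but arbitrary enumeration of the
   (finite) vertex set; another enumeration conjugates both matrices by the same permutation
   matrix, so their spectra do not depend on it. *)
definition vertex_list :: "'a sgraph \<Rightarrow> 'a list" where
  "vertex_list G = (SOME vs. distinct vs \<and> set vs = verts G)"

definition adjacency_mat :: "'a sgraph \<Rightarrow> real mat" where
  "adjacency_mat G = (let vs = vertex_list G; m = card (verts G) in
     mat m m (\<lambda>(i, j). if {vs ! i, vs ! j} \<in> edges G then 1 else 0))"

definition degree_mat :: "'a sgraph \<Rightarrow> real mat" where
  "degree_mat G = (let vs = vertex_list G; m = card (verts G) in
     mat m m (\<lambda>(i, j). if i = j then real (degree G (vs ! i)) else 0))"

(* For a real symmetric matrix of positive dimension the spectrum over the reals is finite and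
   nonempty, so Max is the genuine maximum. *)
definition largest_eigenvalue :: "real mat \<Rightarrow> real" where
  "largest_eigenvalue A = Max (spectrum A)"

definition rho :: "'a sgraph \<Rightarrow> real" where
  "rho G = largest_eigenvalue (adjacency_mat G)"

definition mu :: "'a sgraph \<Rightarrow> real" where
  "mu G = largest_eigenvalue (adjacency_mat G + degree_mat G)"

(* Z n k a b and Z0 n k a b are meant for k < n, k + 1 \<le> a, 1 \<le> b. The side X is
   Inl ` {..<n} with X1 = Inl ` {..<n - k}; the side Y is Inr ` {..<a + b} with
   Y1 = Inr ` {..<b}. *)
definition Z :: "nat \<Rightarrow> nat \<Rightarrow> nat \<Rightarrow> nat \<Rightarrow> (nat + nat) sgraph" where
  "Z n k a b =
     \<lparr>verts = Inl ` {..<n} \<union> Inr ` {..<a + b},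
      edges = {{Inl i, Inr j} | i j. i < n \<and> j < a + b}
              - {{Inl i, Inr j} | i j. i < n - k \<and> j < b}\<rparr>"

(* The deleted edge joins Inr b in Y - Y1 to Inl 0 in X1. All edges between Y - Y1 and X1 are
   equivalent under automorphisms of Z n k a b, so the choice is immaterial. *)
definition Z0 :: "nat \<Rightarrow> nat \<Rightarrow> nat \<Rightarrow> nat \<Rightarrow> (nat + nat) sgraph" where
  "Z0 n k a b =
     \<lparr>verts = verts (Z n k a b), edges = edges (Z n k a b) - {{Inr b, Inl 0}}\<rparr>"

(* F n k and F0 n k are the graphs with third index 0. *)
definition F :: "nat \<Rightarrow> nat \<Rightarrow> (nat + nat) sgraph" where
  "F n k = Z n k (n - k - 1) (k + 1)"

definition F0 :: "nat \<Rightarrow> nat \<Rightarrow> (nat + nat) sgraph" where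
  "F0 n k = Z0 n k (n - k - 1) (k + 1)"

end

theory Submission
  imports Defs "HOL-Analysis.Function_Topology" "HOL-Analysis.Convex"
begin

text \<open>
  The proof has three parts. The first turns the spectral hypothesis into a count of edges, the
  second is purely combinatorial, and the third compares eigenvalues of subgraphs of \<open>F n k\<close>.

  Put \<open>m = n - k - 1\<close>. The graph \<open>F0 n k\<close> contains the complete bipartite graph with sides \<open>m\<close> and
  \<open>n\<close> up to one edge, so evaluating the Rayleigh quotient at the top eigenvector of that complete
  graph bounds both of its eigenvalues from below (\<open>near_complete_lower_bound\<close>). Conversely, in a
  balanced bipartite graph with \<open>e\<close> edges and no isolated vertices, \<open>rho\<^sup>2 \<le> e\<close> and
  \<open>mu \<le> e / n + n\<close> (\<open>adjacency_upper_bound\<close>, \<open>signless_upper_bound\<close>). Hence \<open>e \<ge> m n - 2\<close>: at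
  most \<open>n (k + 1) + 2\<close> pairs between the sides are missing (\<open>few_missing_edges\<close>).

  Suppose that such a graph of minimum degree at least \<open>k\<close> is not traceable, and enlarge it to an
  edge-maximal nontraceable bipartite graph. By a crossing argument, nonadjacent vertices of
  opposite sides then have degree sum at most \<open>n\<close> (\<open>closure_step\<close>). So vertices of degree above
  \<open>n / 2\<close> are adjacent to all such vertices of the other side, and the count of missing pairs
  leaves room for only \<open>0\<close>, \<open>k\<close> or \<open>k + 1\<close> vertices of low degree, all on one side
  (\<open>low_on_one_side\<close>). These can be threaded on a path, which the complete remainder extends to a
  spanning path, unless there are \<open>k + 1\<close> of them with only \<open>k\<close> neighbours in total
  (\<open>dense_traceable_or_deficient\<close>). In that case the graph is a spanning subgraph of \<open>F n k\<close>
  containing all edges at the \<open>k + 1\<close> low vertices.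

  Among those subgraphs other than \<open>F n k\<close> itself, \<open>F0 n k\<close> is the unique maximiser of both
  eigenvalues. Take a nonnegative top eigenvector of the subgraph. Adding edges, or moving edges to
  vertices of no smaller weight, leads to a copy of \<open>F0 n k\<close> on the same vertex set without decreasing
  the quadratic form, and the positivity of the top eigenvector of the connected graph \<open>F0 n k\<close>
  makes the increase of the eigenvalue strict (\<open>missing_edges_decrease_lam\<close>).
\<close>

section \<open>Largest eigenvalues as maxima of quadratic forms\<close>

definition nbrs :: "'a sgraph \<Rightarrow> 'a \<Rightarrow> 'a set" where
  "nbrs G v = {u \<in> verts G. {u, v} \<in> edges G}"

text \<open>The parameter \<open>c\<close> treats both spectra at once: \<open>c = 0\<close> gives the adjacency matrix and
  \<open>c = 1\<close> the signless Laplacian.\<close>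
definition weighted_mat :: "real \<Rightarrow> 'a sgraph \<Rightarrow> real mat" where
  "weighted_mat c G = adjacency_mat G + c \<cdot>\<^sub>m degree_mat G"

definition lam :: "real \<Rightarrow> 'a sgraph \<Rightarrow> real" where
  "lam c G = largest_eigenvalue (weighted_mat c G)"

text \<open>The operator \<open>A + c D\<close> on functions on the vertices, so that no enumeration of the
  vertex set is needed.\<close>
definition act :: "real \<Rightarrow> 'a sgraph \<Rightarrow> ('a \<Rightarrow> real) \<Rightarrow> 'a \<Rightarrow> real" where
  "act c G x v = (\<Sum>u\<in>nbrs G v. x u + c * x v)"

definition sqnorm :: "'a sgraph \<Rightarrow> ('a \<Rightarrow> real) \<Rightarrow> real" where
  "sqnorm G x = (\<Sum>v\<in>verts G. (x v)\<^sup>2)"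

definition qform :: "real \<Rightarrow> 'a sgraph \<Rightarrow> ('a \<Rightarrow> real) \<Rightarrow> real" where
  "qform c G x = (\<Sum>v\<in>verts G. x v * act c G x v)"

lemma rho_lam: "rho G = lam 0 G"
  by (simp add: rho_def lam_def weighted_mat_def adjacency_mat_def degree_mat_def Let_def)
     (rule arg_cong[of _ _ largest_eigenvalue], auto)

lemma mu_lam: "mu G = lam 1 G"
  by (simp add: mu_def lam_def weighted_mat_def adjacency_mat_def degree_mat_def Let_def)
     (rule arg_cong[of _ _ largest_eigenvalue], auto)

lemma weighted_mat_carrier: "weighted_mat c G \<in> carrier_mat (card (verts G)) (card (verts G))"
  by (simp add: weighted_mat_def adjacency_mat_def degree_mat_def Let_def)

lemma vertex_list:
  assumes "finite (verts G)"
  shows "distinct (vertex_list G)" "set (vertex_list G) = verts G"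
    "length (vertex_list G) = card (verts G)"
proof -
  have "\<exists>vs. distinct vs \<and> set vs = verts G"
    using finite_distinct_list[OF assms] by blast
  from someI_ex[OF this] show "distinct (vertex_list G)" "set (vertex_list G) = verts G"
    by (simp_all add: vertex_list_def)
  then show "length (vertex_list G) = card (verts G)" by (metis distinct_card)
qed

lemma sum_vertex_list:
  assumes "finite (verts G)"
  shows "(\<Sum>j<card (verts G). f (vertex_list G ! j)) = (\<Sum>v\<in>verts G. f v)"
  by (metis assms bij_betw_nth sum.reindex_bij_betw vertex_list)

lemma nbrs_simps: "finite (verts G) \<Longrightarrow> finite (nbrs G v)" "nbrs G v \<subseteq> verts G"
    "card (nbrs G v) = degree G v"
  by (auto simp: nbrs_def degree_def)

lemma act_eq_adj:
  assumes "finite (verts G)"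
  shows "act c G x v =
    (\<Sum>u\<in>verts G. if {v, u} \<in> edges G then x u else 0) + c * real (degree G v) * x v"
proof -
  have "(\<Sum>u\<in>nbrs G v. x u) = (\<Sum>u\<in>verts G. if {v, u} \<in> edges G then x u else 0)"
    unfolding nbrs_def using assms by (simp add: sum.inter_filter insert_commute)
  then show ?thesis
    by (simp add: act_def sum.distrib nbrs_simps)
qed

lemma weighted_mat_mult_vec:
  assumes fin: "finite (verts G)" and i: "i < card (verts G)"
  defines "m \<equiv> card (verts G)" and "vs \<equiv> vertex_list G"
  shows "(weighted_mat c G *\<^sub>v vec m (\<lambda>j. x (vs ! j))) $ i = act c G x (vs ! i)"
proof -
  have i': "i < m" using i by (simp add: m_def)
  have "(weighted_mat c G *\<^sub>v vec m (\<lambda>j. x (vs ! j))) $ i =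
     (\<Sum>j<m. ((if {vs ! i, vs ! j} \<in> edges G then 1 else 0) +
        c * (if i = j then real (degree G (vs ! i)) else 0)) * x (vs ! j))"
    using i' unfolding m_def vs_def by (simp add: weighted_mat_def adjacency_mat_def degree_mat_def Let_def
      scalar_prod_def atLeast0LessThan)
  also have "\<dots> = (\<Sum>j<m. if {vs ! i, vs ! j} \<in> edges G then x (vs ! j) else 0) +
      (\<Sum>j<m. if i = j then c * real (degree G (vs ! i)) * x (vs ! i) else 0)"
    unfolding sum.distrib[symmetric] by (intro sum.cong) (auto simp: algebra_simps)
  also have "\<dots> = act c G x (vs ! i)"
    using i' sum_vertex_list[OF fin, of "\<lambda>u. if {vs ! i, u} \<in> edges G then x u else 0"]
    unfolding m_def vs_def by (simp add: act_eq_adj[OF fin])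
  finally show ?thesis .
qed

lemma eigenvalue_iff_act:
  assumes fin: "finite (verts G)"
  shows "eigenvalue (weighted_mat c G) e \<longleftrightarrow>
    (\<exists>x. (\<exists>v\<in>verts G. x v \<noteq> 0) \<and> (\<forall>v\<in>verts G. act c G x v = e * x v))"
proof -
  define m where "m = card (verts G)"
  define vs where "vs = vertex_list G"
  have vs: "distinct vs" "set vs = verts G" "length vs = m"
    using vertex_list[OF fin] by (simp_all add: vs_def m_def)
  have dim: "dim_row (weighted_mat c G) = m"
    using weighted_mat_carrier[of c G] by (auto simp: m_def)
  have ev: "eigenvector (weighted_mat c G) (vec m (\<lambda>j. x (vs ! j))) e \<longleftrightarrow>
      (\<exists>v\<in>verts G. x v \<noteq> 0) \<and> (\<forall>v\<in>verts G. act c G x v = e * x v)" for x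
  proof -
    have 1: "vec m (\<lambda>j. x (vs ! j)) = 0\<^sub>v m \<longleftrightarrow> (\<forall>v\<in>verts G. x v = 0)"
      unfolding vs(2)[symmetric] all_set_conv_all_nth by (auto simp: vec_eq_iff vs(3))
    have 2: "weighted_mat c G *\<^sub>v vec m (\<lambda>j. x (vs ! j)) = e \<cdot>\<^sub>v vec m (\<lambda>j. x (vs ! j)) \<longleftrightarrow>
       (\<forall>v\<in>verts G. act c G x v = e * x v)"
      unfolding vec_eq_iff vs(2)[symmetric] all_set_conv_all_nth
      using weighted_mat_mult_vec[OF fin, folded m_def vs_def, of _ c x]
      by (auto simp: dim vs(3) m_def simp del: index_mult_mat_vec)
    show ?thesis unfolding eigenvector_def dim 1 2 by auto
  qed
  have vecE: "\<exists>x. w = vec m (\<lambda>j. x (vs ! j))" if "w \<in> carrier_vec m" for w :: "real vec"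
  proof -
    have "w $ j = w $ (the_inv_into {..<m} ((!) vs) (vs ! j))" if "j < m" for j
      using the_inv_into_f_f[OF inj_on_nth[OF vs(1)], of "{..<m}" j] that vs(3) by simp
    then show ?thesis using that
      by (intro exI[of _ "\<lambda>v. w $ (the_inv_into {..<m} ((!) vs) v)"]) auto
  qed
  show ?thesis
  proof
    assume "eigenvalue (weighted_mat c G) e"
    then obtain w where w: "eigenvector (weighted_mat c G) w e" by (auto simp: eigenvalue_def)
    then have "w \<in> carrier_vec m" by (simp add: eigenvector_def dim)
    then obtain x where "w = vec m (\<lambda>j. x (vs ! j))" using vecE by blast
    then show "\<exists>x. (\<exists>v\<in>verts G. x v \<noteq> 0) \<and> (\<forall>v\<in>verts G. act c G x v = e * x v)"
      using w ev by blast
  next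
    assume "\<exists>x. (\<exists>v\<in>verts G. x v \<noteq> 0) \<and> (\<forall>v\<in>verts G. act c G x v = e * x v)"
    then show "eigenvalue (weighted_mat c G) e" using ev unfolding eigenvalue_def by blast
  qed
qed

lemma sum_nbrs_swap:
  assumes "finite (verts G)"
  shows "(\<Sum>v\<in>verts G. \<Sum>u\<in>nbrs G v. f u v) = (\<Sum>v\<in>verts G. \<Sum>u\<in>nbrs G v. f v u)"
proof -
  have "(\<Sum>v\<in>verts G. \<Sum>u\<in>nbrs G v. f u v) =
      (\<Sum>v\<in>verts G. \<Sum>u\<in>{u\<in>verts G. {u, v} \<in> edges G}. f u v)"
    by (simp add: nbrs_def)
  also have "\<dots> = (\<Sum>u\<in>verts G. \<Sum>v\<in>{v\<in>verts G. {u, v} \<in> edges G}. f u v)"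
    using assms by (rule sum.swap_restrict[OF _ assms])
  finally show ?thesis by (simp add: nbrs_def insert_commute)
qed

lemma act_symmetric:
  assumes "finite (verts G)"
  shows "(\<Sum>v\<in>verts G. y v * act c G x v) = (\<Sum>v\<in>verts G. x v * act c G y v)"
  using sum_nbrs_swap[OF assms, of "\<lambda>u v. y v * x u"]
  by (simp add: act_def sum_distrib_left algebra_simps sum.distrib)

lemma act_linear: "act c G (\<lambda>v. x v + t * y v) v = act c G x v + t * act c G y v"
  by (simp add: act_def sum_distrib_left sum.distrib[symmetric] algebra_simps)

lemma qform_add:
  assumes "finite (verts G)"
  shows "qform c G (\<lambda>v. x v + t * y v) =
     qform c G x + 2 * t * (\<Sum>v\<in>verts G. y v * act c G x v) + t\<^sup>2 * qform c G y"
proof -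
  have "qform c G (\<lambda>v. x v + t * y v) = qform c G x
      + t * (\<Sum>v\<in>verts G. x v * act c G y v) + t * (\<Sum>v\<in>verts G. y v * act c G x v)
      + t\<^sup>2 * qform c G y"
    by (simp add: qform_def act_linear algebra_simps sum.distrib sum_distrib_left power2_eq_square)
  then show ?thesis using act_symmetric[OF assms, of x c y] by simp
qed

lemma sqnorm_add: "sqnorm G (\<lambda>v. x v + t * y v) =
     sqnorm G x + 2 * t * (\<Sum>v\<in>verts G. y v * x v) + t\<^sup>2 * sqnorm G y"
  by (simp add: sqnorm_def power2_eq_square algebra_simps sum.distrib sum_distrib_left)

lemma sqnorm_pos: "finite (verts G) \<Longrightarrow> v \<in> verts G \<Longrightarrow> x v \<noteq> 0 \<Longrightarrow> sqnorm G x > 0"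
  unfolding sqnorm_def by (rule sum_pos2[of _ v]) auto

lemma quadratic_nonneg_linear_zero:
  fixes p q :: real
  assumes "\<And>t. 0 \<le> 2 * t * p + t\<^sup>2 * q"
  shows "p = 0"
proof (rule ccontr)
  assume p: "p \<noteq> 0"
  \<comment> \<open>A step against the slope, short enough for the linear term to dominate.\<close>
  define t where "t = - p / (\<bar>q\<bar> + 1)"
  have pos: "\<bar>q\<bar> + 1 > 0" by simp
  have "t\<^sup>2 * q \<le> t\<^sup>2 * (\<bar>q\<bar> + 1)" by (intro mult_left_mono) auto
  also have "\<dots> = p\<^sup>2 / (\<bar>q\<bar> + 1)" using pos by (simp add: t_def power2_eq_square)
  finally have "t\<^sup>2 * q \<le> p\<^sup>2 / (\<bar>q\<bar> + 1)" .
  moreover have "2 * t * p = - 2 * (p\<^sup>2 / (\<bar>q\<bar> + 1))" by (simp add: t_def power2_eq_square)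
  moreover have "p\<^sup>2 / (\<bar>q\<bar> + 1) > 0" using p pos by simp
  ultimately show False using assms[of t] by linarith
qed

text \<open>If \<open>x\<close> attains the bound \<open>M\<close>, then \<open>M |x|^2 - qform x\<close> is minimal at \<open>x\<close>, so its
  derivative in each coordinate direction vanishes; that derivative is twice the corresponding
  entry of \<open>M x - (A + c D) x\<close>.\<close>
lemma rayleigh_equality_eigenvector:
  assumes fin: "finite (verts G)"
    and le: "\<And>x. qform c G x \<le> M * sqnorm G x"
    and eq: "qform c G x = M * sqnorm G x" and v: "v \<in> verts G"
  shows "act c G x v = M * x v"
proof -
  let ?e = "\<lambda>u. if u = v then 1 else (0::real)"
  have s1: "(\<Sum>u\<in>verts G. ?e u * f u) = f v" for f :: "_ \<Rightarrow> real"
    using fin v by (simp add: if_distrib if_distribR cong: if_cong)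
  have "0 \<le> 2 * t * (M * x v - act c G x v) + t\<^sup>2 * (M * sqnorm G ?e - qform c G ?e)" for t
    using le[of "\<lambda>u. x u + t * ?e u"]
    unfolding qform_add[OF fin] sqnorm_add s1 eq by (simp add: algebra_simps)
  from quadratic_nonneg_linear_zero[OF this] show ?thesis by simp
qed

lemma qform_scale: "qform c G (\<lambda>v. t * x v) = t\<^sup>2 * qform c G x"
  using act_linear[of c G "\<lambda>_. 0" t x]
  by (simp add: qform_def act_def power2_eq_square sum_distrib_left algebra_simps)

lemma qform_cong: "(\<And>v. v \<in> verts G \<Longrightarrow> x v = y v) \<Longrightarrow> qform c G x = qform c G y"
  unfolding qform_def act_def nbrs_def by (intro sum.cong refl arg_cong2[where f="(*)"]) auto

text \<open>The unit sphere of functions supported on the finite vertex set is compact, being a closed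
  subset of a product of intervals and singletons, and the form is continuous.\<close>
lemma rayleigh_max_exists:
  assumes fin: "finite (verts G)" and ne: "verts G \<noteq> {}"
  shows "\<exists>x. sqnorm G x = 1 \<and> (\<forall>y. qform c G y \<le> qform c G x * sqnorm G y)"
proof -
  let ?V = "verts G"
  define B where "B = PiE UNIV (\<lambda>v. if v \<in> ?V then {-1..1::real} else {0})"
  define S where "S = B \<inter> {x. sqnorm G x = 1}"
  have "compactin (product_topology (\<lambda>_. euclidean) UNIV) B"
    unfolding B_def by (subst compactin_PiE) auto
  then have cB: "compact B" by (simp add: euclidean_product_topology)
  have coord: "continuous_on A (\<lambda>x::'a\<Rightarrow>real. x v)" for A v
    by (rule continuous_on_subset[OF continuous_on_product_coordinates]) simp
  have "continuous_on UNIV (sqnorm G)" unfolding sqnorm_def[abs_def]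
    by (intro continuous_intros coord)
  then have "closed {x. sqnorm G x = 1}"
    by (intro closed_Collect_eq continuous_on_const)
  then have cS: "compact S" unfolding S_def using cB by (rule compact_Int_closed[rotated])
  obtain v0 where v0: "v0 \<in> ?V" using ne by auto
  have norm_S: "x \<in> S" if "\<And>v. v \<notin> ?V \<Longrightarrow> x v = 0" "sqnorm G x = 1" for x
  proof -
    have "\<bar>x v\<bar> \<le> 1" if "v \<in> ?V" for v
    proof -
      have "(x v)\<^sup>2 \<le> sqnorm G x" unfolding sqnorm_def
        by (rule member_le_sum[OF that _ fin]) auto
      then show ?thesis using \<open>sqnorm G x = 1\<close> by (simp add: abs_square_le_1)
    qed
    then have "-1 \<le> x v \<and> x v \<le> 1" if "v \<in> ?V" for v
      using that by (simp add: abs_le_iff)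
    then show ?thesis using that by (auto simp: S_def B_def)
  qed
  have "(\<lambda>v. if v = v0 then 1 else 0) \<in> S"
    using v0 fin by (intro norm_S) (auto simp: sqnorm_def if_distrib if_distribR cong: if_cong)
  then have "S \<noteq> {}" by auto
  moreover have "continuous_on S (qform c G)" unfolding qform_def[abs_def] act_def
    by (intro continuous_intros coord)
  ultimately obtain x where x: "x \<in> S" "\<And>y. y \<in> S \<Longrightarrow> qform c G y \<le> qform c G x"
    using continuous_attains_sup[OF cS] by blast
  have "qform c G y \<le> qform c G x * sqnorm G y" for y
  proof (cases "\<forall>v\<in>?V. y v = 0")
    case True
    then have "qform c G y = qform c G (\<lambda>_. 0)" by (intro qform_cong) auto
    then show ?thesis using True by (simp add: qform_def act_def sqnorm_def)
  next
    case False
    then have pos: "sqnorm G y > 0" using sqnorm_pos[OF fin] by blast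
    define y' where "y' v = (if v \<in> ?V then (1 / sqrt (sqnorm G y)) * y v else 0)" for v
    have "sqnorm G y' = (\<Sum>v\<in>?V. (y v)\<^sup>2 / sqnorm G y)"
      using pos by (simp add: sqnorm_def[of G y'] y'_def power_divide)
    also have "\<dots> = 1" using pos by (simp add: sum_divide_distrib[symmetric] sqnorm_def)
    finally have "y' \<in> S" by (intro norm_S) (auto simp: y'_def)
    then have "qform c G y' \<le> qform c G x" by (rule x(2))
    moreover have "qform c G y' = qform c G (\<lambda>v. (1 / sqrt (sqnorm G y)) * y v)"
      by (rule qform_cong) (simp add: y'_def)
    ultimately have "qform c G y / sqnorm G y \<le> qform c G x"
      using pos by (simp only: qform_scale) (simp add: power_divide)
    then show ?thesis using pos by (simp add: divide_le_eq)
  qed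
  then show ?thesis using x(1) by (auto simp: S_def)
qed

lemma qform_eigenvector:
  assumes "\<And>v. v \<in> verts G \<Longrightarrow> act c G x v = e * x v"
  shows "qform c G x = e * sqnorm G x"
  using assms by (simp add: qform_def sqnorm_def sum_distrib_left power2_eq_square algebra_simps)

lemma qform_le_abs: "qform c G x \<le> qform c G (\<lambda>v. \<bar>x v\<bar>)"
proof -
  have "x v * (x u + c * x v) \<le> \<bar>x v\<bar> * (\<bar>x u\<bar> + c * \<bar>x v\<bar>)" for u v
  proof -
    have "x v * x u \<le> \<bar>x v\<bar> * \<bar>x u\<bar>" by (metis abs_ge_self abs_mult)
    then show ?thesis by (simp add: distrib_left mult.left_commute)
  qed
  then show ?thesis
    unfolding qform_def act_def sum_distrib_left by (intro sum_mono)
qed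

lemma sqnorm_abs: "sqnorm G (\<lambda>v. \<bar>x v\<bar>) = sqnorm G x"
  by (simp add: sqnorm_def)

text \<open>The maximiser of the form on the sphere is an eigenvector, so its value is an eigenvalue;
  every other eigenvalue is a value of the form on the sphere. Thus the spectrum over the reals
  is nonempty and its maximum is the maximum of the form.\<close>
theorem lam_rayleigh:
  assumes fin: "finite (verts G)" and ne: "verts G \<noteq> {}"
  shows lam_upper: "qform c G y \<le> lam c G * sqnorm G y"
    and lam_attained: "\<exists>x. sqnorm G x = 1 \<and> qform c G x = lam c G"
proof -
  obtain x where x: "sqnorm G x = 1" and
    max: "\<And>y. qform c G y \<le> qform c G x * sqnorm G y"
    using rayleigh_max_exists[OF fin ne] by blast
  define M where "M = qform c G x"
  have eig: "act c G x v = M * x v" if "v \<in> verts G" for v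
    by (rule rayleigh_equality_eigenvector[OF fin _ _ that]) (use max x in \<open>auto simp: M_def\<close>)
  have "\<exists>v\<in>verts G. x v \<noteq> 0"
  proof (rule ccontr)
    assume "\<not> ?thesis"
    then have "sqnorm G x = 0" by (simp add: sqnorm_def)
    then show False using x by simp
  qed
  then have mem: "M \<in> spectrum (weighted_mat c G)"
    unfolding spectrum_def using eigenvalue_iff_act[OF fin] eig by blast
  have "e \<le> M" if e: "e \<in> spectrum (weighted_mat c G)" for e
  proof -
    obtain y v where y: "v \<in> verts G" "y v \<noteq> 0" "\<And>v. v \<in> verts G \<Longrightarrow> act c G y v = e * y v"
      using e eigenvalue_iff_act[OF fin] unfolding spectrum_def by blast
    have "e * sqnorm G y \<le> M * sqnorm G y"
      using qform_eigenvector[OF y(3)] max[of y] by (simp add: M_def)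
    then show ?thesis using sqnorm_pos[OF fin y(1), of y] y(2) by simp
  qed
  then have "lam c G = M"
    unfolding lam_def largest_eigenvalue_def
    using mem card_finite_spectrum(1)[OF weighted_mat_carrier] by (intro Max_eqI) auto
  then show "qform c G y \<le> lam c G * sqnorm G y" "\<exists>x. sqnorm G x = 1 \<and> qform c G x = lam c G"
    using max x by (auto simp: M_def)
qed

lemma lam_eigenvector:
  assumes "finite (verts G)" "verts G \<noteq> {}" "qform c G x = lam c G * sqnorm G x" "v \<in> verts G"
  shows "act c G x v = lam c G * x v"
  using rayleigh_equality_eigenvector[OF assms(1) lam_upper[OF assms(1,2)] assms(3,4)] .

text \<open>Passing to absolute values does not decrease the form, so a maximiser may be taken
  nonnegative. Positivity follows from connectedness, for the graphs that need it, in
  \<open>block_minus_positive\<close>.\<close>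
lemma nonneg_top_eigenvector:
  assumes fin: "finite (verts G)" and ne: "verts G \<noteq> {}"
  shows "\<exists>z. (\<forall>v. 0 \<le> z v) \<and> sqnorm G z = 1 \<and>
    (\<forall>v\<in>verts G. act c G z v = lam c G * z v)"
proof -
  obtain x where x: "sqnorm G x = 1" "qform c G x = lam c G"
    using lam_attained[OF fin ne] by blast
  let ?z = "\<lambda>v. \<bar>x v\<bar>"
  have n: "sqnorm G ?z = 1" using x by (simp add: sqnorm_abs)
  have q: "qform c G ?z = lam c G * sqnorm G ?z"
    using qform_le_abs[of c G x] lam_upper[OF fin ne, of c ?z] x n by simp
  have "\<forall>v\<in>verts G. act c G ?z v = lam c G * ?z v"
    using lam_eigenvector[OF fin ne q] by blast
  then show ?thesis using n by (intro exI[of _ ?z]) simp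
qed

text \<open>Transporting functions along an isomorphism preserves the form and the norm.\<close>
lemma lam_iso:
  assumes iso: "graph_iso G H" and fin: "finite (verts G)" and ne: "verts G \<noteq> {}"
  shows "lam c G = lam c H"
proof -
  obtain f where f: "bij_betw f (verts G) (verts H)" and
    E: "\<And>u v. u \<in> verts G \<Longrightarrow> v \<in> verts G \<Longrightarrow> {u, v} \<in> edges G \<longleftrightarrow> {f u, f v} \<in> edges H"
    using iso by (auto simp: graph_iso_def)
  have finH: "finite (verts H)" using f fin bij_betw_finite by blast
  have neH: "verts H \<noteq> {}" using f ne by (auto simp: bij_betw_def)
  have nb: "bij_betw f (nbrs G v) (nbrs H (f v))" if "v \<in> verts G" for v
  proof -
    have "f ` nbrs G v = nbrs H (f v)"
    proof (intro equalityI subsetI)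
      fix w assume "w \<in> f ` nbrs G v"
      then show "w \<in> nbrs H (f v)"
        using E[OF _ that] f by (auto simp: nbrs_def bij_betw_def)
    next
      fix w assume w: "w \<in> nbrs H (f v)"
      then obtain u where "u \<in> verts G" "w = f u"
        using f by (auto simp: nbrs_def bij_betw_def)
      then show "w \<in> f ` nbrs G v" using w E[OF _ that, of u] by (auto simp: nbrs_def)
    qed
    then show ?thesis
      using bij_betw_subset[OF f nbrs_simps(2)] by blast
  qed
  have act: "act c G (\<lambda>v. x (f v)) v = act c H x (f v)" if "v \<in> verts G" for x v
    unfolding act_def using sum.reindex_bij_betw[OF nb[OF that], of "\<lambda>u. x u + c * x (f v)"] by simp
  have q: "qform c G (\<lambda>v. x (f v)) = qform c H x" for x
    unfolding qform_def using act sum.reindex_bij_betw[OF f, of "\<lambda>v. x v * act c H x v"] by simp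
  have s: "sqnorm G (\<lambda>v. x (f v)) = sqnorm H x" for x
    unfolding sqnorm_def using sum.reindex_bij_betw[OF f, of "\<lambda>v. (x v)\<^sup>2"] by simp
  let ?g = "the_inv_into (verts G) f"
  have inv: "?g (f v) = v" if "v \<in> verts G" for v
    using f that by (auto simp: bij_betw_def the_inv_into_f_f)
  have q': "qform c H (\<lambda>w. x (?g w)) = qform c G x" for x
    unfolding q[symmetric] using inv by (intro qform_cong) simp
  have s': "sqnorm H (\<lambda>w. x (?g w)) = sqnorm G x" for x
    unfolding s[symmetric] unfolding sqnorm_def using inv by (intro sum.cong) simp_all
  obtain x where x: "sqnorm G x = 1" "qform c G x = lam c G"
    using lam_attained[OF fin ne] by blast
  obtain y where y: "sqnorm H y = 1" "qform c H y = lam c H"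
    using lam_attained[OF finH neH] by blast
  show ?thesis
    using lam_upper[OF finH neH, of c "\<lambda>w. x (?g w)"] lam_upper[OF fin ne, of c "\<lambda>v. y (f v)"]
    by (simp add: q q' s s' x y)
qed

section \<open>Spanning paths in balanced bipartite graphs\<close>

definition adj :: "('a \<times> 'a) set \<Rightarrow> 'a \<Rightarrow> 'a \<Rightarrow> bool" where
  "adj R u v \<longleftrightarrow> (u, v) \<in> R \<or> (v, u) \<in> R"

definition spanning_path :: "'a set \<Rightarrow> ('a \<times> 'a) set \<Rightarrow> 'a list \<Rightarrow> bool" where
  "spanning_path V R p \<longleftrightarrow> distinct p \<and> set p = V \<and> successively (adj R) p"

lemma adj_commute: "adj R u v \<longleftrightarrow> adj R v u"
  by (auto simp: adj_def)

lemma adj_converse: "adj (R\<inverse>) = adj R"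
  by (auto simp: adj_def fun_eq_iff)

lemma successively_adj_rev: "successively (adj R) (rev p) \<longleftrightarrow> successively (adj R) p"
  using adj_commute[of R] by (simp add: fun_eq_iff)

lemma not_successively_split:
  "\<not> successively P p \<Longrightarrow> \<exists>a x y b. p = a @ x # y # b \<and> \<not> P x y"
proof (induction p rule: induct_list012)
  case (3 x y zs)
  show ?case
  proof (cases "P x y")
    case True
    then obtain a x' y' b where "y # zs = a @ x' # y' # b" "\<not> P x' y'" using 3 by auto
    then show ?thesis by (metis append_Cons)
  qed (metis append_Nil)
qed auto

locale bigraph =
  fixes X Y :: "'a set" and R :: "('a \<times> 'a) set" and n :: nat
  assumes finX: "finite X" and finY: "finite Y" and disj: "X \<inter> Y = {}"
    and RXY: "R \<subseteq> X \<times> Y" and cardX: "card X = n" and cardY: "card Y = n"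
begin

lemma bigraph_converse: "bigraph Y X (R\<inverse>) n"
  using finX finY disj RXY cardX cardY by unfold_locales auto

lemma nbrX: "R `` {x} \<subseteq> Y" "finite (R `` {x})" "card (R `` {x}) \<le> n"
proof -
  show 1: "R `` {x} \<subseteq> Y" using RXY by auto
  show "finite (R `` {x})" "card (R `` {x}) \<le> n"
    using finite_subset[OF 1 finY] card_mono[OF finY 1] cardY by auto
qed

lemma nbrY: "R\<inverse> `` {y} \<subseteq> X" "finite (R\<inverse> `` {y})" "card (R\<inverse> `` {y}) \<le> n"
  using bigraph.nbrX[OF bigraph_converse] by auto

text \<open>A bipartite closure step in the manner of Bondy and Chvatal. Cut the path at the new edge
  \<open>uv\<close> into \<open>p1\<close>, ending in \<open>u\<close>, and \<open>p2\<close>, starting in \<open>v\<close>. If \<open>v\<close> is adjacent to the first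
  vertex, reversing \<open>p1\<close> repairs the path. Otherwise the predecessors on the path of the
  neighbours of \<open>v\<close> all exist and lie in \<open>Y\<close>, where the neighbours of \<open>u\<close> lie as well; the
  degree condition forces a common vertex, i.e. consecutive \<open>w\<close>, \<open>x\<close> with \<open>u\<close> adjacent to
  \<open>w\<close> and \<open>v\<close> adjacent to \<open>x\<close>. Exchanging \<open>uv\<close> and \<open>wx\<close> for \<open>uw\<close> and \<open>vx\<close> gives a path.\<close>
lemma closure_step:
  assumes u: "u \<in> X" and v: "v \<in> Y" and uv: "(u, v) \<notin> R"
    and deg: "n < card (R `` {u}) + card (R\<inverse> `` {v})"
    and p: "spanning_path (X \<union> Y) (insert (u, v) R) p"
  shows "\<exists>q. spanning_path (X \<union> Y) R q"
proof (cases "successively (adj R) p")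
  case True
  then show ?thesis using p by (auto simp: spanning_path_def)
next
  case False
  let ?R' = "insert (u, v) R"
  \<comment> \<open>Up to reversal, the path runs through the new edge from \<open>u\<close> to \<open>v\<close>.\<close>
  have "\<exists>a b. spanning_path (X \<union> Y) ?R' (a @ u # v # b)"
  proof -
    obtain a x y b where xy: "p = a @ x # y # b" "\<not> adj R x y"
      using not_successively_split[OF False] by blast
    have "adj ?R' x y" using p xy(1) by (simp add: spanning_path_def successively_append_iff)
    then have "x = u \<and> y = v \<or> x = v \<and> y = u" using xy(2) by (auto simp: adj_def)
    then show ?thesis
    proof
      assume "x = v \<and> y = u"
      then have "spanning_path (X \<union> Y) ?R' (rev b @ u # v # rev a)"
        using p xy(1) successively_adj_rev[of ?R' p]
        by (auto simp: spanning_path_def)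
      then show ?thesis by blast
    qed (use p xy(1) in blast)
  qed
  then obtain a b where ab: "spanning_path (X \<union> Y) ?R' (a @ u # v # b)" by blast
  define p1 p2 where "p1 = a @ [u]" and "p2 = v # b"
  have p12: "distinct (p1 @ p2)" "set p1 \<union> set p2 = X \<union> Y" "successively (adj ?R') (p1 @ p2)"
    using ab by (auto simp: p1_def p2_def spanning_path_def)
  have "v \<notin> set p1" "u \<notin> set p2" using p12(1) by (auto simp: p1_def p2_def)
  then have s1: "successively (adj R) p1" and s2: "successively (adj R) p2"
    using p12(3)
    by (auto simp: successively_append_iff adj_def intro: successively_mono
        cong: successively_cong)
  have ne: "p1 \<noteq> []" "p2 \<noteq> []" "last p1 = u" "hd p2 = v" by (auto simp: p1_def p2_def)
  have sp: "spanning_path (X \<union> Y) R q"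
    if "set q = set p1 \<union> set p2" "distinct q" "successively (adj R) q" for q
    using that p12(2) by (simp add: spanning_path_def)
  show ?thesis
  proof (cases "adj R (hd p1) v")
    case True
    have "spanning_path (X \<union> Y) R (rev p1 @ p2)"
      using p12(1) ne True s1 s2
      by (intro sp) (auto simp: successively_append_iff successively_adj_rev last_rev
          simp del: successively_rev)
    then show ?thesis by blast
  next
    case False
    let ?p = "p1 @ p2"
    have "\<exists>j. Suc j < length ?p \<and> ?p ! Suc j = x" if x: "x \<in> R\<inverse> `` {v}" for x
    proof -
      have "x \<in> set ?p" using x p12(2) nbrY(1) by auto
      then obtain i where i: "i < length ?p" "?p ! i = x" by (auto simp only: in_set_conv_nth)
      have "hd ?p \<noteq> x" using False x ne by (auto simp: adj_def hd_append)
      then have "i \<noteq> 0" using i ne(1) by (metis append_is_Nil_conv hd_conv_nth)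
      then show ?thesis using i by (metis Suc_pred neq0_conv)
    qed
    then obtain g where g: "\<And>x. x \<in> R\<inverse> `` {v} \<Longrightarrow> Suc (g x) < length ?p \<and> ?p ! Suc (g x) = x"
      by metis
    let ?f = "\<lambda>x. ?p ! g x"
    have inj: "inj_on ?f (R\<inverse> `` {v})"
      using g nth_eq_iff_index_eq[OF p12(1)] by (intro inj_onI) (metis Suc_lessD)
    have fY: "?f ` (R\<inverse> `` {v}) \<subseteq> Y"
    proof
      fix w assume "w \<in> ?f ` (R\<inverse> `` {v})"
      then obtain x where x: "x \<in> R\<inverse> `` {v}" "w = ?p ! g x" by blast
      have "adj ?R' w x" using p12(3) g[OF x(1)] x(2) unfolding successively_conv_nth by metis
      then show "w \<in> Y" using x(1) RXY u v disj by (auto simp: adj_def)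
    qed
    have "R `` {u} \<inter> ?f ` (R\<inverse> `` {v}) \<noteq> {}"
    proof
      assume "R `` {u} \<inter> ?f ` (R\<inverse> `` {v}) = {}"
      then have "card (R `` {u} \<union> ?f ` (R\<inverse> `` {v})) = card (R `` {u}) + card (R\<inverse> `` {v})"
        using nbrX(2) nbrY(2) inj by (subst card_Un_disjoint) (auto simp: card_image)
      moreover have "card (R `` {u} \<union> ?f ` (R\<inverse> `` {v})) \<le> n"
        using nbrX(1) fY cardY by (metis Un_least card_mono finY)
      ultimately show False using deg by simp
    qed
    then obtain x where x: "x \<in> R\<inverse> `` {v}" "?p ! g x \<in> R `` {u}" by blast
    define j where "j = g x"
    have j: "Suc j < length ?p" "adj R u (?p ! j)" "adj R v (?p ! Suc j)"
      using g[OF x(1)] x by (auto simp: j_def adj_def)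
    have "?p ! j \<in> Y" using x(2) nbrX(1) j_def by auto
    then have jne: "j \<noteq> length a" using u disj by (auto simp: p1_def)
    show ?thesis
    proof (cases "j < length a")
      case True
      define c d where "c = take (Suc j) p1" and "d = drop (Suc j) p1"
      have len: "Suc j < length p1" using True by (simp add: p1_def)
      have cd: "p1 = c @ d" "c \<noteq> []" "d \<noteq> []" "last d = u"
        using len ne(3) by (auto simp: c_def d_def)
      have "last c = ?p ! j" "hd d = ?p ! Suc j"
        using len by (auto simp: c_def d_def take_Suc_conv_app_nth hd_drop_conv_nth nth_append)
      then have "spanning_path (X \<union> Y) R (c @ rev d @ p2)"
        using s1 s2 p12(1) j cd(2-4) ne(2,4) unfolding cd(1)
        by (intro sp) (auto simp: successively_append_iff successively_adj_rev last_rev hd_rev cd(1)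
          adj_commute[of R _ u] adj_commute[of R _ v] simp del: successively_rev)
      then show ?thesis by blast
    next
      case False
      define j' where "j' = j - length p1"
      have j': "j = length p1 + j'" using False jne by (simp add: j'_def p1_def)
      define c d where "c = take (Suc j') p2" and "d = drop (Suc j') p2"
      have len: "Suc j' < length p2" using j(1) j' by simp
      have cd: "p2 = c @ d" "c \<noteq> []" "d \<noteq> []" "hd c = v"
        using len ne(4) by (auto simp: c_def d_def)
      have "last c = ?p ! j" "hd d = ?p ! Suc j"
        using len j' by (auto simp: c_def d_def take_Suc_conv_app_nth hd_drop_conv_nth nth_append)
      then have "spanning_path (X \<union> Y) R (p1 @ rev c @ d)"
        using s1 s2 p12(1) j cd(2-4) ne(1,3) unfolding cd(1)
        by (intro sp) (auto simp: successively_append_iff successively_adj_rev last_rev hd_rev cd(1)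
          simp del: successively_rev)
      then show ?thesis by blast
    qed
  qed
qed

text \<open>An alternating path from \<open>X\<close> to \<open>Y\<close> with equally many vertices on both sides, possibly
  empty: the form in which pieces of a spanning path can be concatenated.\<close>
definition lace :: "'a list \<Rightarrow> bool" where
  "lace p \<longleftrightarrow> distinct p \<and> set p \<subseteq> X \<union> Y \<and> successively (adj R) p \<and>
     (p \<noteq> [] \<longrightarrow> hd p \<in> X \<and> last p \<in> Y) \<and> card (set p \<inter> X) = card (set p \<inter> Y)"

lemma lace_Nil: "lace []"
  by (simp add: lace_def)

lemma lace_pair: "(x, y) \<in> R \<Longrightarrow> lace [x, y]"
  using RXY disj by (auto simp: lace_def adj_def Int_insert_left)

lemma lace_append:
  assumes p: "lace p" and q: "lace q" and pq: "set p \<inter> set q = {}"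
    and join: "p \<noteq> [] \<Longrightarrow> q \<noteq> [] \<Longrightarrow> (hd q, last p) \<in> R"
  shows "lace (p @ q)"
proof -
  have "card ((set p \<union> set q) \<inter> Z) = card (set p \<inter> Z) + card (set q \<inter> Z)" for Z
    unfolding Int_Un_distrib2 using pq by (intro card_Un_disjoint) auto
  then show ?thesis using assms
    by (auto simp: lace_def successively_append_iff adj_def hd_append last_append)
qed

lemma lace_snoc:
  assumes "lace p" "(x, y) \<in> R" "x \<notin> set p" "y \<notin> set p" "p \<noteq> [] \<Longrightarrow> (x, last p) \<in> R"
  shows "lace (p @ [x, y])"
  by (rule lace_append[OF assms(1) lace_pair[OF assms(2)]]) (use assms in auto)

lemma lace_Cons:
  assumes "lace p" "(x, y) \<in> R" "x \<notin> set p" "y \<notin> set p" "p \<noteq> [] \<Longrightarrow> (hd p, y) \<in> R"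
  shows "lace (x # y # p)"
  using lace_append[OF lace_pair[OF assms(2)] assms(1)] assms by auto

lemma lace_complete_pair:
  assumes "A \<subseteq> X" "B \<subseteq> Y" "card A = card B" "A \<times> B \<subseteq> R" "a \<in> A"
  shows "\<exists>p. lace p \<and> set p = A \<union> B \<and> p \<noteq> [] \<and> hd p = a"
  using assms
proof (induction "card A" arbitrary: A B a)
  case 0
  then have "finite A" using finX finite_subset by auto
  then show ?case using 0 by simp
next
  case (Suc m)
  have fin: "finite A" "finite B"
    using finite_subset[OF Suc.prems(1) finX] finite_subset[OF Suc.prems(2) finY] by auto
  have "B \<noteq> {}" using Suc.hyps(2) Suc.prems(3) by auto
  then obtain b where b: "b \<in> B" by auto
  have ab: "(a, b) \<in> R" using b Suc.prems by auto
  define A' B' where "A' = A - {a}" and "B' = B - {b}"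
  have c: "card A' = m" "card B' = m"
    using Suc.hyps(2) Suc.prems b fin by (simp_all add: A'_def B'_def)
  show ?case
  proof (cases "A' = {}")
    case True
    then have "B' = {}" using c fin by (simp add: B'_def)
    then have "A = {a}" "B = {b}" using True Suc.prems b by (auto simp: A'_def B'_def)
    then show ?thesis using lace_pair[OF ab] by (intro exI[of _ "[a, b]"]) auto
  next
    case False
    then obtain a' where a': "a' \<in> A'" by auto
    obtain p where p: "lace p" "set p = A' \<union> B'" "p \<noteq> []" "hd p = a'"
    proof -
      have "A' \<subseteq> X" "B' \<subseteq> Y" "card A' = card B'" "A' \<times> B' \<subseteq> R"
        using Suc.prems c by (auto simp: A'_def B'_def)
      from Suc.hyps(1)[OF c(1)[symmetric] this a'] show thesis using that by blast
    qed
    have "lace ([a, b] @ p)"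
      using p ab Suc.prems b a' disj
      by (intro lace_append lace_pair) (auto simp: A'_def B'_def)
    then show ?thesis using p Suc.prems b
      by (intro exI[of _ "[a, b] @ p"]) (auto simp: A'_def B'_def)
  qed
qed

text \<open>Once a lace has absorbed all vertices of \<open>X\<close> that miss something in \<open>Y\<close>, the remaining
  vertices induce a balanced complete bipartite graph and can be appended in any order.\<close>
lemma spanning_path_of_lace:
  assumes p: "lace p" and compl: "(X - set p) \<times> Y \<subseteq> R"
  shows "\<exists>q. spanning_path (X \<union> Y) R q"
proof (cases "X - set p = {}")
  case True
  have e: "card (X - set p) = card (Y - set p)"
    using p cardX cardY finX finY
    by (simp add: card_Diff_subset_Int Int_commute lace_def)
  then have "Y - set p = {}" using True finY by simp
  then have "spanning_path (X \<union> Y) R p"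
    using True p by (auto simp: lace_def spanning_path_def)
  then show ?thesis by blast
next
  case False
  have e: "card (X - set p) = card (Y - set p)"
    using p cardX cardY finX finY
    by (simp add: card_Diff_subset_Int Int_commute lace_def)
  obtain a where a: "a \<in> X - set p" using False by blast
  obtain q where q: "lace q" "set q = (X - set p) \<union> (Y - set p)" "q \<noteq> []" "hd q = a"
    using lace_complete_pair[OF _ _ e _ a] compl by blast
  have "lace (p @ q)"
  proof (rule lace_append[OF p q(1)])
    show "set p \<inter> set q = {}" using q(2) by auto
    show "(hd q, last p) \<in> R" if "p \<noteq> []"
      using that p a compl q(4) by (auto simp: lace_def)
  qed
  moreover have "set (p @ q) = X \<union> Y" using q(2) p by (auto simp: lace_def)
  ultimately have "spanning_path (X \<union> Y) R (p @ q)" by (simp add: lace_def spanning_path_def)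
  then show ?thesis by blast
qed

end

section \<open>Closed dense bipartite graphs\<close>

text \<open>An edge-maximal nontraceable bipartite graph has this property, by \<open>closure_step\<close>.\<close>
locale closed_bigraph = bigraph +
  assumes closed: "x \<in> X \<Longrightarrow> y \<in> Y \<Longrightarrow> (x, y) \<notin> R \<Longrightarrow>
     card (R `` {x}) + card (R\<inverse> `` {y}) \<le> n"
begin

lemma closed_bigraph_converse: "closed_bigraph Y X (R\<inverse>) n"
proof -
  interpret c: bigraph Y X "R\<inverse>" n by (rule bigraph_converse)
  show ?thesis using closed by unfold_locales (auto simp: add.commute)
qed

text \<open>Two vertices of opposite sides outside these sets have degree sum above \<open>n\<close> and are adjacent
  by closedness, so all missing pairs meet one of these sets.\<close>
definition lowX :: "'a set" where "lowX = {x \<in> X. 2 * card (R `` {x}) \<le> n}"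
definition lowY :: "'a set" where "lowY = {y \<in> Y. 2 * card (R\<inverse> `` {y}) \<le> n}"

lemma low_simps: "lowX \<subseteq> X" "lowY \<subseteq> Y" "finite lowX" "finite lowY"
  using finX finY by (auto simp: lowX_def lowY_def)

lemma high_adjacent: "x \<in> X - lowX \<Longrightarrow> y \<in> Y - lowY \<Longrightarrow> (x, y) \<in> R"
  using closed[of x y] by (fastforce simp: lowX_def lowY_def)

text \<open>A low vertex \<open>x\<close> misses some high \<open>y\<close>; as \<open>y\<close> is adjacent to all high vertices of \<open>X\<close>,
  closedness turns the large degree of \<open>y\<close> into a small bound on the degree of \<open>x\<close>.\<close>
lemma low_degree:
  assumes x: "x \<in> lowX" and few: "2 * card lowY < n"
  shows "card (R `` {x}) \<le> card lowX"
proof -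
  have "\<not> Y - lowY \<subseteq> R `` {x}"
  proof
    assume "Y - lowY \<subseteq> R `` {x}"
    then have "card (Y - lowY) \<le> card (R `` {x})" by (intro card_mono nbrX)
    moreover have "card (Y - lowY) = n - card lowY"
      using low_simps cardY by (simp add: card_Diff_subset)
    ultimately show False using x few by (auto simp: lowX_def)
  qed
  then obtain y where y: "y \<in> Y - lowY" "(x, y) \<notin> R" by blast
  have "X - lowX \<subseteq> R\<inverse> `` {y}" using high_adjacent y by auto
  then have "card (X - lowX) \<le> card (R\<inverse> `` {y})" by (intro card_mono nbrY)
  moreover have "card (X - lowX) = n - card lowX"
    using low_simps cardX by (simp add: card_Diff_subset)
  moreover have "card (R `` {x}) + card (R\<inverse> `` {y}) \<le> n"
    using closed x y by (auto simp: lowX_def)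
  moreover have "card lowX \<le> n" using low_simps cardX finX by (metis card_mono)
  ultimately show ?thesis by linarith
qed

lemma missing_rows:
  assumes A: "A \<subseteq> X" and d: "\<And>x. x \<in> A \<Longrightarrow> card (R `` {x}) + e \<le> n"
  shows "card A * e \<le> card (A \<times> Y - R)"
proof -
  have "A \<times> Y - R = Sigma A (\<lambda>x. Y - R `` {x})" by auto
  moreover have "finite A" using A finX finite_subset by blast
  ultimately have "card (A \<times> Y - R) = (\<Sum>x\<in>A. card (Y - R `` {x}))"
    using finY by (simp add: card_SigmaI)
  moreover have "e \<le> card (Y - R `` {x})" if "x \<in> A" for x
    using d[OF that] nbrX cardY by (subst card_Diff_subset) (auto simp: le_diff_conv2)
  then have "(\<Sum>x\<in>A. e) \<le> (\<Sum>x\<in>A. card (Y - R `` {x}))" by (rule sum_mono)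
  ultimately show ?thesis by simp
qed

text \<open>Each low vertex misses at least half of the opposite side.\<close>
lemma lowX_few: "card lowX * n \<le> 2 * card (X \<times> Y - R)"
proof -
  have "card lowX * ((n + 1) div 2) \<le> card (lowX \<times> Y - R)"
    by (rule missing_rows) (auto simp: lowX_def)
  also have "\<dots> \<le> card (X \<times> Y - R)"
    using finX finY low_simps by (intro card_mono) auto
  finally have "2 * (card lowX * ((n + 1) div 2)) \<le> 2 * card (X \<times> Y - R)"
    by (rule mult_left_mono) simp
  moreover have "card lowX * n \<le> card lowX * (2 * ((n + 1) div 2))" by (intro mult_left_mono) auto
  then have "card lowX * n \<le> 2 * (card lowX * ((n + 1) div 2))" by (simp only: mult.left_commute)
  ultimately show ?thesis by linarith
qed

lemma card_converse_missing: "card (B \<times> A - R\<inverse>) = card (A \<times> B - R)"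
proof -
  have "B \<times> A - R\<inverse> = (\<lambda>(x, y). (y, x)) ` (A \<times> B - R)" by force
  then show ?thesis by (simp add: card_image inj_on_def split_beta prod_eq_iff)
qed

lemma lowY_few: "card lowY * n \<le> 2 * card (X \<times> Y - R)"
  using closed_bigraph.lowX_few[OF closed_bigraph_converse]
  by (simp add: closed_bigraph.lowX_def[OF closed_bigraph_converse] lowY_def card_converse_missing)

lemma low_degreeY:
  "y \<in> lowY \<Longrightarrow> 2 * card lowX < n \<Longrightarrow> card (R\<inverse> `` {y}) \<le> card lowY"
  using closed_bigraph.low_degree[OF closed_bigraph_converse]
  by (simp add: closed_bigraph.lowX_def[OF closed_bigraph_converse]
      closed_bigraph.lowY_def[OF closed_bigraph_converse] lowY_def lowX_def)

text \<open>Inclusion-exclusion for the missing pairs that meet a low vertex of either side.\<close>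
lemma missing_both:
  assumes "2 * card lowX < n" "2 * card lowY < n"
  shows "card lowX * (n - card lowX) + card lowY * (n - card lowY)
    \<le> card (X \<times> Y - R) + card lowX * card lowY"
proof -
  let ?A = "lowX \<times> Y - R" and ?B = "X \<times> lowY - R"
  have fin: "finite ?A" "finite ?B" using finX finY low_simps by auto
  have "card lowX * (n - card lowX) \<le> card ?A"
    using low_degree assms by (intro missing_rows low_simps) fastforce
  moreover have "card lowY * (n - card lowY) \<le> card (lowY \<times> X - R\<inverse>)"
    using low_degreeY assms low_simps
    by (intro closed_bigraph.missing_rows[OF closed_bigraph_converse]) fastforce+
  moreover have "card (lowY \<times> X - R\<inverse>) = card ?B"
    by (rule card_converse_missing)
  moreover have "card ?A + card ?B = card (?A \<union> ?B) + card (?A \<inter> ?B)"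
    using fin by (rule card_Un_Int)
  moreover have "card (?A \<union> ?B) \<le> card (X \<times> Y - R)"
    using finX finY low_simps by (intro card_mono) auto
  moreover have "card (?A \<inter> ?B) \<le> card (lowX \<times> lowY)"
    using low_simps by (intro card_mono) auto
  ultimately show ?thesis by (simp add: card_cartesian_product)
qed

text \<open>Let \<open>s\<close> and \<open>t\<close> be the numbers of low vertices in \<open>X\<close> and \<open>Y\<close>. A low vertex has degree
  between \<open>k\<close> and the number of low vertices on its side, so \<open>s\<close> and \<open>t\<close> are zero or at least
  \<open>k\<close>. With low vertices on both sides, about \<open>2 k n\<close> pairs would be missing, and with more than
  \<open>k + 1\<close> on one side, about \<open>(k + 2) n\<close>; both exceed \<open>(k + 1) n + 2\<close> once \<open>n \<ge> 2 (k + 2)\<^sup>2\<close>.\<close>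
lemma low_on_one_side:
  assumes k: "2 \<le> k" and n: "2 * (k + 2)\<^sup>2 \<le> n"
    and degX: "\<And>x. x \<in> X \<Longrightarrow> k \<le> card (R `` {x})"
    and degY: "\<And>y. y \<in> Y \<Longrightarrow> k \<le> card (R\<inverse> `` {y})"
    and miss: "card (X \<times> Y - R) \<le> n * (k + 1) + 2"
  shows "lowX = {} \<or> lowY = {}" "card lowX \<in> {0, k, k + 1}" "card lowY \<in> {0, k, k + 1}"
proof -
  define s t M where "s = int (card lowX)" and "t = int (card lowY)" and "M = int (card (X \<times> Y - R))"
  define K N where "K = int k" and "N = int n"
  have "int (2 * (k + 2)\<^sup>2) \<le> int n" "int (card (X \<times> Y - R)) \<le> int (n * (k + 1) + 2)"
    using n miss by (simp_all only: of_nat_le_iff)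
  then have K: "2 \<le> K" "2 * (K + 2)\<^sup>2 \<le> N" "M \<le> N * (K + 1) + 2"
    using of_nat_le_iff[where 'a=int, THEN iffD2, OF k] unfolding K_def N_def M_def
    by (simp_all only: of_nat_mult of_nat_power of_nat_add of_nat_numeral of_nat_1 of_nat_le_iff)
  have KK: "4 * K \<le> 2 * K\<^sup>2" using K(1) by (simp add: power2_eq_square)
  have N: "2 * K\<^sup>2 + 8 * K + 8 \<le> N" using K(2) by (simp add: power2_eq_square algebra_simps)
  have bound: "r \<le> 2 * K + 2" if "r * N \<le> 2 * M" for r
  proof (rule ccontr)
    assume "\<not> r \<le> 2 * K + 2"
    then have "(2 * K + 3) * N \<le> r * N" using N K KK by (intro mult_right_mono) linarith+
    then show False using that K(3) N K(1) KK by (simp add: algebra_simps)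
  qed
  have "int (card lowX * n) \<le> int (2 * card (X \<times> Y - R))"
    "int (card lowY * n) \<le> int (2 * card (X \<times> Y - R))"
    using lowX_few lowY_few by (simp_all only: of_nat_le_iff)
  then have sN: "s * N \<le> 2 * M" "t * N \<le> 2 * M"
    by (simp_all add: s_def t_def M_def N_def)
  have s: "0 \<le> s" "s \<le> 2 * K + 2" and t: "0 \<le> t" "t \<le> 2 * K + 2"
    using bound sN by (auto simp: s_def t_def)
  have few: "2 * card lowX < n" "2 * card lowY < n"
    using s t N K(1) KK unfolding s_def t_def N_def by linarith+
  have ks: "K \<le> s" if "lowX \<noteq> {}"
    using that low_degree[OF _ few(2)] degX unfolding s_def K_def by (fastforce simp: lowX_def)
  have kt: "K \<le> t" if "lowY \<noteq> {}"
    using that low_degreeY[OF _ few(1)] degY unfolding t_def K_def by (fastforce simp: lowY_def)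
  have "int (card lowX * (n - card lowX) + card lowY * (n - card lowY))
      \<le> int (card (X \<times> Y - R) + card lowX * card lowY)"
    using missing_both[OF few] by (simp only: of_nat_le_iff)
  then have mb: "s * (N - s) + t * (N - t) \<le> M + s * t"
    using few by (simp add: s_def t_def N_def M_def of_nat_diff)
  show one: "lowX = {} \<or> lowY = {}"
  proof (rule ccontr)
    assume "\<not> ?thesis"
    then have le: "K \<le> s" "K \<le> t" using ks kt by auto
    \<comment> \<open>The count in \<open>mb\<close> is smallest for \<open>s = t = K\<close>: first \<open>s\<close>, then \<open>t\<close> is lowered to \<open>K\<close>.\<close>
    have "0 \<le> (s - K) * (N - s - K - t)" "0 \<le> (t - K) * (N - t - 2 * K)"
      using le s t N K(1) KK by (auto intro!: mult_nonneg_nonneg)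
    then have "2 * K * N - 3 * K\<^sup>2 \<le> M"
      using mb by (simp add: algebra_simps power2_eq_square)
    then have "N * (K - 1) \<le> 3 * K\<^sup>2 + 2" using K(3) by (simp add: algebra_simps)
    moreover have "(2 * K\<^sup>2 + 8 * K + 8) * (K - 1) \<le> N * (K - 1)"
      using N K(1) by (intro mult_right_mono) auto
    moreover have "(2 * K\<^sup>2 + 8 * K + 8) * (K - 1) = 2 * K ^ 3 + 6 * K\<^sup>2 - 8"
      by (simp add: algebra_simps power2_eq_square power3_eq_cube)
    moreover have "2 * K\<^sup>2 \<le> K ^ 3" using K(1) by (simp add: power2_eq_square power3_eq_cube)
    ultimately show False using KK K(1) by linarith
  qed
  have no_big: "r \<le> K + 1" if "0 \<le> r" "r \<le> 2 * K + 2" "r * (N - r) \<le> M" for r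
  proof (rule ccontr)
    assume "\<not> r \<le> K + 1"
    then have "0 \<le> (r - K - 2) * (N - r - K - 2)"
      using that N K(1) KK by (intro mult_nonneg_nonneg) linarith+
    then have "(K + 2) * (N - K - 2) \<le> M" using that(3) by (simp add: algebra_simps)
    moreover have "(K + 2) * (N - K - 2) = N * (K + 1) + N - K\<^sup>2 - 4 * K - 4"
      by (simp add: algebra_simps power2_eq_square)
    ultimately show False using K(3) N KK K(1) by linarith
  qed
  show "card lowX \<in> {0, k, k + 1}"
  proof (cases "lowX = {}")
    case False
    then have "t = 0" using one by (simp add: t_def)
    then have "s \<le> K + 1" using no_big[OF s] mb by simp
    then show ?thesis using ks[OF False] unfolding s_def K_def by auto
  qed simp
  show "card lowY \<in> {0, k, k + 1}"
  proof (cases "lowY = {}")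
    case False
    then have "s = 0" using one by (simp add: s_def)
    then have "t \<le> K + 1" using no_big[OF t] mb by simp
    then show ?thesis using kt[OF False] unfolding t_def K_def by auto
  qed simp
qed

section \<open>Threading the low vertices\<close>

text \<open>Let \<open>S\<close> be the set of low vertices of \<open>X\<close> and \<open>T\<close> the set of their common neighbours. By
  \<open>spanning_path_of_lace\<close> it suffices to find a lace through \<open>S\<close>. Closedness makes the
  neighbourhoods in \<open>S\<close> rigid (fact \<open>key\<close>): a vertex of \<open>Y\<close> that misses some vertex of \<open>S\<close> has
  no neighbour in \<open>S\<close> if \<open>S\<close> has \<open>k\<close> elements, and at most one if \<open>S\<close> has \<open>k + 1\<close>.

  In the first case \<open>S\<close> and \<open>T\<close> have the same size and are completely joined. In the second case
  every vertex \<open>x\<close> of \<open>S\<close> is adjacent to \<open>T\<close> and to a set \<open>P x\<close> of private neighbours. If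
  there are no private neighbours, then either \<open>S\<close> and \<open>T\<close> again have the same size or \<open>S\<close> has
  only \<open>k\<close> neighbours. If some \<open>c\<close> has one, every other vertex of \<open>S\<close> has degree exactly \<open>k\<close>,
  hence \<open>k - card T\<close> private neighbours, and this number determines how to assemble the lace.\<close>
lemma traceable_or_deficient_of_low:
  assumes k: "2 \<le> k" and n: "4 * k + 4 < n"
    and degX: "\<And>x. x \<in> X \<Longrightarrow> k \<le> card (R `` {x})"
    and low: "lowY = {}" "card lowX \<in> {0, k, k + 1}"
  shows "(\<exists>p. spanning_path (X \<union> Y) R p) \<or> (card lowX = k + 1 \<and> card (R `` lowX) = k)"
proof -
  define S where "S = lowX"
  have S: "S \<subseteq> X" "finite S" using low_simps by (auto simp: S_def)
  have compl: "(X - S) \<times> Y \<subseteq> R" using high_adjacent low by (auto simp: S_def)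
  have key: "card (R\<inverse> `` {y} \<inter> S) + card (R `` {x}) \<le> card S"
    if "x \<in> S" "y \<in> Y" "(x, y) \<notin> R" for x y
  proof -
    have "R\<inverse> `` {y} = (X - S) \<union> (R\<inverse> `` {y} \<inter> S)" using compl that RXY by auto
    then have "card (R\<inverse> `` {y}) = card (X - S) + card (R\<inverse> `` {y} \<inter> S)"
      using finX S by (metis Diff_disjoint Int_commute Int_left_commute card_Un_disjoint
          finite_Diff finite_Int inf_bot_right)
    moreover have "card (X - S) = n - card S" "card S \<le> n"
      using S cardX finX by (simp_all add: card_Diff_subset, metis card_mono)
    ultimately show ?thesis using closed[of x y] that S by fastforce
  qed
  define T where "T = {y \<in> Y. \<forall>x\<in>S. (x, y) \<in> R}"
  have T: "T \<subseteq> Y" "finite T" "S \<times> T \<subseteq> R" using finY by (auto simp: T_def)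
  have finish: "\<exists>p. spanning_path (X \<union> Y) R p" if "lace p" "S \<subseteq> set p" for p
    using spanning_path_of_lace[OF that(1)] that(2) compl by blast
  have equal_card: "\<exists>p. spanning_path (X \<union> Y) R p" if eqc: "card S = card T"
  proof (cases "S = {}")
    case True
    then show ?thesis using finish[OF lace_Nil] by simp
  next
    case False
    then obtain a where a: "a \<in> S" by blast
    obtain p where "lace p" "set p = S \<union> T"
      using lace_complete_pair[OF S(1) T(1) eqc T(3) a] by blast
    then show ?thesis using finish[of p] by auto
  qed
  have degS: "k \<le> card (R `` {x})" "card (R `` {x}) \<le> card S" if "x \<in> S" for x
  proof -
    show "k \<le> card (R `` {x})" using that degX S by blast
    have "2 * card (R `` {x}) \<le> n" using that by (simp add: S_def lowX_def)
    then have "\<not> Y \<subseteq> R `` {x}" using card_mono[OF nbrX(2), of Y x] cardY n by auto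
    then obtain y where "y \<in> Y" "(x, y) \<notin> R" by auto
    from key[OF that this] show "card (R `` {x}) \<le> card S" by simp
  qed
  consider "card S = 0" | "card S = k" | "card S = k + 1" using low by (auto simp: S_def)
  then show ?thesis
  proof cases
    case 1
    then show ?thesis using finish[OF lace_Nil] S by simp
  next
    case 2
    then obtain x where x: "x \<in> S" using k by fastforce
    have "R `` {x} = T"
    proof (intro equalityI subsetI)
      fix y assume y: "y \<in> R `` {x}"
      have "(x', y) \<in> R" if "x' \<in> S" for x'
      proof (rule ccontr)
        assume "(x', y) \<notin> R"
        then have "card (R\<inverse> `` {y} \<inter> S) = 0"
          using key[OF that, of y] degS[OF that] 2 y nbrX(1) by fastforce
        then show False using x y S(2) by auto
      qed
      then show "y \<in> T" using y nbrX(1) by (auto simp: T_def)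
    qed (use T x in auto)
    then have "card T = card S" using degS[OF x] 2 by simp
    then show ?thesis using equal_card by simp
  next
    case 3
    define P where "P x = R `` {x} - T" for x
    have P: "finite (P x)" "P x \<subseteq> Y" "y \<in> P x \<Longrightarrow> (x, y) \<in> R" "P x \<inter> T = {}" for x y
      using nbrX[of x] by (auto simp: P_def)
    have card_P: "card (R `` {x}) = card T + card (P x)" if "x \<in> S" for x
    proof -
      have "T \<subseteq> R `` {x}" using T that by auto
      then show ?thesis using nbrX(2)[of x] T(2) by (simp add: P_def card_Diff_subset card_mono)
    qed
    have priv: "(x', y) \<notin> R \<and> card (R `` {x'}) = k"
      if "y \<in> P x" "x \<in> S" "x' \<in> S" "x' \<noteq> x" for x x' y
    proof -
      have y: "y \<in> Y" "(x, y) \<in> R" "y \<notin> T" using that P(2)[of x] by (auto simp: P_def)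
      then obtain z where z: "z \<in> S" "(z, y) \<notin> R" by (auto simp: T_def)
      have le: "card (R\<inverse> `` {y} \<inter> S) \<le> 1" using key[OF z(1) y(1) z(2)] degS(1)[OF z(1)] 3 by simp
      have n': "(x', y) \<notin> R"
      proof
        assume "(x', y) \<in> R"
        then have "{x, x'} \<subseteq> R\<inverse> `` {y} \<inter> S" using y that by auto
        then have "card {x, x'} \<le> card (R\<inverse> `` {y} \<inter> S)" using S by (intro card_mono) auto
        then have "card {x, x'} \<le> 1" using le by simp
        then show False using that by simp
      qed
      have "x \<in> R\<inverse> `` {y} \<inter> S" using y that by auto
      then have "0 < card (R\<inverse> `` {y} \<inter> S)" using S(2) by (auto simp: card_gt_0_iff)
      then show ?thesis using key[OF that(3) y(1) n'] degS(1)[OF that(3)] 3 n' by simp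
    qed
    have XY: "x \<notin> T" "y \<notin> S" "x \<noteq> y" if "x \<in> X" "y \<in> Y" for x y
      using that disj S T by auto
    have disjP: "P x \<inter> P x' = {}" if "x \<in> S" "x' \<in> S" "x \<noteq> x'" for x x'
      using priv[of _ x x'] that P(3) by auto
    show ?thesis
    proof (cases "\<exists>c\<in>S. P c \<noteq> {}")
      case False
      obtain x where x: "x \<in> S" using 3 by fastforce
      have "R `` S = T" using False T(3) x by (auto simp: P_def)
      moreover have "card T = card (R `` {x})" using card_P[OF x] False x by simp
      ultimately have "card T = k + 1 \<or> card (R `` S) = k" using degS[OF x] 3 by auto
      then show ?thesis using equal_card 3 by (auto simp: S_def)
    next
      case True
      then obtain c pc where c: "c \<in> S" "pc \<in> P c" by blast
      have cX: "c \<in> X" "c \<in> S" using c S by auto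
      have cpc: "(c, pc) \<in> R" "pc \<in> Y" "pc \<notin> T" using P(2,4)[of c] P(3)[of pc c] c by auto
      have "card (S - {c}) = k" using c 3 S by simp
      then have neSc: "S - {c} \<noteq> {}" using k by (metis card.empty not_numeral_le_zero)
      have other: "card T + card (P x) = k" if "x \<in> S" "x \<noteq> c" for x
        using priv[OF c(2,1) that] card_P[OF that(1)] by simp
      have "\<exists>p. spanning_path (X \<union> Y) R p"
      proof -
        consider "card T = k" | "card T = k - 1" | "card T + 2 \<le> k"
        proof -
          obtain x where "x \<in> S - {c}" using neSc by blast
          then show thesis using other[of x] that by fastforce
        qed
        then show ?thesis
        proof cases
          \<comment> \<open>\<open>T\<close> links the \<open>k\<close> vertices of \<open>S\<close> other than \<open>c\<close>, and \<open>c\<close> leaves through \<open>pc\<close>.\<close>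
          case 1
          obtain a where a: "a \<in> S - {c}" using neSc by blast
          obtain p where p: "lace p" "set p = (S - {c}) \<union> T" "p \<noteq> []"
          proof -
            have "S - {c} \<subseteq> X" "(S - {c}) \<times> T \<subseteq> R" using S T by blast+
            moreover have "card (S - {c}) = card T" using \<open>card (S - {c}) = k\<close> 1 by simp
            ultimately show thesis using lace_complete_pair[of "S - {c}" T a] T(1) a that by blast
          qed
          have "last p \<in> T" using p S disj last_in_set[OF p(3)] by (auto simp: lace_def)
          then have "(c, last p) \<in> R" using c T by auto
          then have "lace (p @ [c, pc])"
            using p(1,2) cpc cX XY by (intro lace_snoc) auto
          then show ?thesis by (rule finish) (use p in auto)
        next
          \<comment> \<open>\<open>T\<close> is one short: a second vertex \<open>a\<close> of \<open>S\<close> becomes the other end of the path and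
            is joined by private neighbours and one vertex \<open>x\<close> outside \<open>S\<close>.\<close>
          case 2
          obtain a where a: "a \<in> S - {c}" using neSc by blast
          have ca: "card (S - {c} - {a}) = k - 1" using a \<open>card (S - {c}) = k\<close> S by simp
          then have "card (S - {c} - {a}) \<noteq> 0" using k by simp
          then have "S - {c} - {a} \<noteq> {}" by (metis card.empty)
          then obtain h where h: "h \<in> S - {c} - {a}" by blast
          have "card (P a) = 1" "card (P h) = 1" using other[of a] other[of h] a h 2 k by auto
          then have "P a \<noteq> {}" "P h \<noteq> {}" by (metis card.empty zero_neq_one)+
          then obtain pa ph where pp: "pa \<in> P a" "ph \<in> P h" by blast
          have pp': "(a, pa) \<in> R" "pa \<in> Y" "pa \<notin> T" "(h, ph) \<in> R" "ph \<in> Y" "ph \<notin> T"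
            using pp P(2,4)[of a] P(2,4)[of h] P(3)[of pa a] P(3)[of ph h] by auto
          have ne: "pa \<noteq> ph" "pa \<noteq> pc" "ph \<noteq> pc"
            using disjP[of a h] disjP[of a c] disjP[of h c] a h c pp by auto
          obtain p where p: "lace p" "set p = (S - {c} - {a}) \<union> T" "p \<noteq> []" "hd p = h"
          proof -
            have "S - {c} - {a} \<subseteq> X" "(S - {c} - {a}) \<times> T \<subseteq> R" using S T by blast+
            moreover have "card (S - {c} - {a}) = card T" using ca 2 by simp
            ultimately show thesis using lace_complete_pair[of "S - {c} - {a}" T h] T(1) h that by blast
          qed
          have last: "last p \<in> T" using p S disj last_in_set[OF p(3)] by (auto simp: lace_def)
          then have "(c, last p) \<in> R" using c T by auto
          then have l1: "lace (p @ [c, pc])"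
            using p(1,2) cpc cX XY by (intro lace_snoc) auto
          have "card (X - S) > 0" using S cardX finX n 3 by (simp add: card_Diff_subset)
          then have "X - S \<noteq> {}" by (metis card.empty less_irrefl)
          then obtain x where x: "x \<in> X - S" by blast
          have xR: "(x, ph) \<in> R" "(x, pa) \<in> R" using x compl pp' by auto
          have aX: "a \<in> X" "a \<noteq> c" "a \<noteq> x" "c \<noteq> x" "a \<in> S" "x \<in> X" "x \<notin> S" "h \<in> X"
            using a x c S h by auto
          have Yout: "a \<notin> Y" "c \<notin> Y" "x \<notin> Y" "a \<notin> T" "c \<notin> T" "x \<notin> T"
              "pa \<notin> S" "ph \<notin> S" "pc \<notin> S"
            using aX cX cpc(2) pp' disj S(1) T(1) by auto
          have "x \<notin> set (p @ [c, pc])" "ph \<notin> set (p @ [c, pc])"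
            using p(2) Yout aX cX cpc(2,3) pp'(2,3,5,6) ne by auto
          then have l2: "lace (x # ph # p @ [c, pc])"
            using l1 xR pp' p(3,4) by (intro lace_Cons) auto
          have "a \<notin> set (x # ph # p @ [c, pc])" "pa \<notin> set (x # ph # p @ [c, pc])"
            using p(2) Yout aX cX cpc(2,3) pp'(2,3,5,6) ne by auto
          then have "lace (a # pa # x # ph # p @ [c, pc])"
            by (rule lace_Cons[OF l2 pp'(1)]) (simp add: xR)
          then show ?thesis by (rule finish) (use p in auto)
        next
          \<comment> \<open>Every vertex of \<open>S\<close> has two private neighbours. \<open>T\<close> links as many vertices of \<open>S\<close> as
            it can; each other \<open>b\<close> is passed between two private neighbours, entered from a fresh
            vertex outside \<open>S\<close>.\<close>
          case 3
          then have two: "2 \<le> card (P x)" if "x \<in> S" for x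
            using card_P[OF that] degS(1)[OF that] by simp
          obtain A where A: "A \<subseteq> S" "card A = card T" "finite A"
            using obtain_subset_with_card_n[of "card T" S] 3 \<open>card S = k + 1\<close> by auto
          have start: "\<exists>p. lace p \<and> set p = A \<union> T"
          proof (cases "A = {}")
            case True
            then have "T = {}" using A T by simp
            then show ?thesis using True lace_Nil by (intro exI[of _ "[]"]) auto
          next
            case False
            then obtain a where "a \<in> A" by blast
            then show ?thesis using lace_complete_pair[of A T a] A S T by blast
          qed
          have "\<exists>p. lace p \<and> set p \<inter> S = A \<union> B \<and> set p \<inter> Y \<subseteq> T \<union> (\<Union>b\<in>B. P b)
              \<and> card (set p \<inter> X) \<le> card T + 2 * card B"
            if "finite B" "B \<subseteq> S - A" for B
            using that
          proof (induction B rule: finite_induct)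
            case empty
            obtain p where p: "lace p" "set p = A \<union> T" using start by blast
            have "set p \<inter> X = A" "set p \<inter> S = A" "set p \<inter> Y = T"
              using p A S T disj by auto
            then show ?case using p A by (intro exI[of _ p]) auto
          next
            case (insert b B)
            then obtain p where p: "lace p" "set p \<inter> S = A \<union> B" "set p \<inter> Y \<subseteq> T \<union> (\<Union>b\<in>B. P b)"
              "card (set p \<inter> X) \<le> card T + 2 * card B" by auto
            have b: "b \<in> S" "b \<notin> A" "b \<notin> B" using insert by auto
            have "\<not> card (P b) \<le> Suc 0" using two[OF b(1)] by simp
            then obtain q q' where q: "q \<in> P b" "q' \<in> P b" "q \<noteq> q'"
              using P(1)[of b] by (auto simp: card_le_Suc0_iff_eq)
            have qq: "(b, q) \<in> R" "(b, q') \<in> R" "q \<in> Y" "q' \<in> Y" using q P(2)[of b] P(3)[of q b] P(3)[of q' b] by auto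
            have qT: "q \<notin> T" "q' \<notin> T" using q P(4)[of b] by auto
            have "P b' \<inter> P b = {}" if "b' \<in> B" for b'
              using disjP[of b' b] that insert b by auto
            then have nq: "q \<notin> set p" "q' \<notin> set p" using p(3) q qq qT by auto
            have "card B \<le> card S" using insert.prems S by (intro card_mono) auto
            then have "card (set p \<inter> X) < card (X - S)"
              using p(4) 3 \<open>card S = k + 1\<close> S n cardX finX by (simp add: card_Diff_subset)
            then have "\<not> X - S \<subseteq> set p \<inter> X"
              by (meson List.finite_set card_mono finite_Int not_less)
            then obtain x where x: "x \<in> X - S" "x \<notin> set p" by blast
            have xq: "(x, y) \<in> R" if "y \<in> Y" for y using x compl that by auto
            have bp: "b \<notin> set p" using p(2) b by auto
            have bX: "b \<in> X" "x \<in> X" "x \<noteq> b" using x b S by auto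
            have bq: "b \<noteq> q" "q' \<noteq> x" using bX qq disj by auto
            have l1: "lace (p @ [x, q])"
              using p(1) xq qq(3) x(2) nq by (intro lace_snoc) (auto simp: lace_def)
            have "lace ((p @ [x, q]) @ [b, q'])"
              by (rule lace_snoc[OF l1 qq(2)]) (use qq(1) bX(3) bq bp nq q(3) in auto)
            then have "lace (p @ [x, q] @ [b, q'])" by simp
            moreover have "set (p @ [x, q] @ [b, q']) \<inter> S = A \<union> insert b B"
              using p(2) b x qq S disj by auto
            moreover have "set (p @ [x, q] @ [b, q']) \<inter> Y \<subseteq> T \<union> (\<Union>b\<in>insert b B. P b)"
              using p(3) b x q S disj by auto
            moreover have "card (set (p @ [x, q] @ [b, q']) \<inter> X) \<le> card T + 2 * card (insert b B)"
            proof -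
              have "set (p @ [x, q] @ [b, q']) \<inter> X \<subseteq> (set p \<inter> X) \<union> {x, b}"
                using qq disj by auto
              then have "card (set (p @ [x, q] @ [b, q']) \<inter> X) \<le> card ((set p \<inter> X) \<union> {x, b})"
                by (intro card_mono) auto
              also have "\<dots> \<le> card (set p \<inter> X) + card {x, b}" by (rule card_Un_le)
              also have "card {x, b} \<le> 2" by (simp add: card_insert_if)
              finally show ?thesis using p(4) insert.hyps by simp
            qed
            ultimately show ?case by blast
          qed
          from this[of "S - A"] obtain p where "lace p" "set p \<inter> S = A \<union> (S - A)"
            using S by auto
          then show ?thesis using finish[of p] A by auto
        qed
      qed
      then show ?thesis by blast
    qed
  qed
qed

end

text \<open>Apply the preceding analysis to an edge-maximal nontraceable supergraph. Supergraphs inherit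
  the degree bounds and the bound on missing pairs, and a set with few neighbours in the
  supergraph has few neighbours in the original graph.\<close>
theorem (in bigraph) dense_traceable_or_deficient:
  assumes k: "2 \<le> k" and n: "2 * (k + 2)\<^sup>2 \<le> n"
    and degX: "\<And>x. x \<in> X \<Longrightarrow> k \<le> card (R `` {x})"
    and degY: "\<And>y. y \<in> Y \<Longrightarrow> k \<le> card (R\<inverse> `` {y})"
    and miss: "card (X \<times> Y - R) \<le> n * (k + 1) + 2"
  shows "(\<exists>p. spanning_path (X \<union> Y) R p)
     \<or> (\<exists>S\<subseteq>X. card S = k + 1 \<and> card (R `` S) \<le> k)
     \<or> (\<exists>S\<subseteq>Y. card S = k + 1 \<and> card (R\<inverse> `` S) \<le> k)"
proof (cases "\<exists>p. spanning_path (X \<union> Y) R p")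
  case False
  define Q where "Q = {R'. R \<subseteq> R' \<and> R' \<subseteq> X \<times> Y \<and> \<not> (\<exists>p. spanning_path (X \<union> Y) R' p)}"
  have "finite Q"
    by (rule finite_subset[of _ "Pow (X \<times> Y)"]) (use finX finY in \<open>auto simp: Q_def\<close>)
  moreover have "R \<in> Q" using False RXY by (auto simp: Q_def)
  ultimately obtain H where H: "H \<in> Q" and max: "\<And>R'. R' \<in> Q \<Longrightarrow> H \<subseteq> R' \<Longrightarrow> H = R'"
    using finite_has_maximal[of Q] by blast
  have RH: "R \<subseteq> H" and HXY: "H \<subseteq> X \<times> Y" and Hno: "\<And>p. \<not> spanning_path (X \<union> Y) H p"
    using H by (auto simp: Q_def)
  interpret h: bigraph X Y H n
    using finX finY disj HXY cardX cardY by unfold_locales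
  interpret h: closed_bigraph X Y H n
  proof
    fix x y assume xy: "x \<in> X" "y \<in> Y" "(x, y) \<notin> H"
    have "\<exists>p. spanning_path (X \<union> Y) (insert (x, y) H) p"
    proof (rule ccontr)
      assume "\<not> ?thesis"
      then have "insert (x, y) H \<in> Q" using RH HXY xy by (auto simp: Q_def)
      from max[OF this] xy(3) show False by auto
    qed
    then show "card (H `` {x}) + card (H\<inverse> `` {y}) \<le> n"
      using h.closure_step[OF xy] Hno by (metis not_less)
  qed
  have dX: "k \<le> card (H `` {x})" if "x \<in> X" for x
    using degX[OF that] card_mono[OF h.nbrX(2), of "R `` {x}" x] RH by fastforce
  have dY: "k \<le> card (H\<inverse> `` {y})" if "y \<in> Y" for y
    using degY[OF that] card_mono[OF h.nbrY(2), of "R\<inverse> `` {y}" y] RH by fastforce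
  have "card (X \<times> Y - H) \<le> card (X \<times> Y - R)"
    using RH finX finY by (intro card_mono) auto
  then have miss': "card (X \<times> Y - H) \<le> n * (k + 1) + 2" using miss by simp
  note low = h.low_on_one_side[OF k n dX dY miss']
  have "4 * k + 4 < 2 * (k + 2)\<^sup>2" by (simp add: power2_eq_square)
  then have n4: "4 * k + 4 < n" using n by simp
  interpret c: closed_bigraph Y X "H\<inverse>" n by (rule h.closed_bigraph_converse)
  have lows: "c.lowX = h.lowY" "c.lowY = h.lowX"
    unfolding c.lowX_def c.lowY_def h.lowX_def h.lowY_def by auto
  consider "h.lowY = {}" | "h.lowX = {}" using low(1) by blast
  then show ?thesis
  proof cases
    case 1
    then have S: "card h.lowX = k + 1 \<and> card (H `` h.lowX) = k"
      using h.traceable_or_deficient_of_low[OF k n4 dX 1 low(2)] Hno by blast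
    have "finite (H `` h.lowX)" using HXY finY by (rule_tac finite_subset[of _ Y]) auto
    then have "card (R `` h.lowX) \<le> k" using card_mono[of "H `` h.lowX" "R `` h.lowX"] S RH by auto
    then show ?thesis using S h.low_simps by blast
  next
    case 2
    then have S: "card h.lowY = k + 1 \<and> card (H\<inverse> `` h.lowY) = k"
      using c.traceable_or_deficient_of_low[OF k n4] dY Hno low(3)
      unfolding lows by (auto simp: Un_commute spanning_path_def adj_converse)
    have "finite (H\<inverse> `` h.lowY)" using HXY finX by (rule_tac finite_subset[of _ X]) auto
    then have "card (R\<inverse> `` h.lowY) \<le> k"
      using card_mono[of "H\<inverse> `` h.lowY" "R\<inverse> `` h.lowY"] S RH by auto
    then show ?thesis using S h.low_simps by blast
  qed
qed simp

section \<open>Edge counts and eigenvalues\<close>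

definition bip :: "'a set \<Rightarrow> 'a set \<Rightarrow> ('a \<times> 'a) set \<Rightarrow> 'a sgraph" where
  "bip X Y R = \<lparr>verts = X \<union> Y, edges = {{x, y} | x y. (x, y) \<in> R}\<rparr>"

lemma verts_bip [simp]: "verts (bip X Y R) = X \<union> Y"
  by (simp add: bip_def)

lemma edge_bip [simp]: "{u, v} \<in> edges (bip X Y R) \<longleftrightarrow> adj R u v"
  by (auto simp: bip_def adj_def doubleton_eq_iff)

lemma bip_converse: "bip Y X (R\<inverse>) = bip X Y R"
  by (auto simp: bip_def insert_commute)

lemma graph_eq_bip:
  assumes "bipartition G U W"
  shows "G = bip U W {(u, w). u \<in> U \<and> w \<in> W \<and> {u, w} \<in> edges G}"
proof -
  have "edges G = edges (bip U W {(u, w). u \<in> U \<and> w \<in> W \<and> {u, w} \<in> edges G})"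
    using assms unfolding bipartition_def bip_def by (auto 4 4)
  then show ?thesis using assms by (simp add: bip_def bipartition_def)
qed

context bigraph
begin

abbreviation "G \<equiv> bip X Y R"

lemma finG: "finite (verts G)"
  using finX finY by simp

lemma nbrs_bipX: "x \<in> X \<Longrightarrow> nbrs G x = R `` {x}"
  using RXY disj by (auto simp: nbrs_def adj_def)

lemma nbrs_bipY: "y \<in> Y \<Longrightarrow> nbrs G y = R\<inverse> `` {y}"
  using RXY disj by (auto simp: nbrs_def adj_def)

lemma finR: "finite R"
  using RXY finX finY finite_subset by blast

lemma sum_rows: "(\<Sum>x\<in>X. \<Sum>y\<in>R `` {x}. f x y) = (\<Sum>(x, y)\<in>R. f x y)"
proof -
  have "R = Sigma X (\<lambda>x. R `` {x})" using RXY by auto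
  then show ?thesis using finX nbrX(2) by (subst sum.Sigma) auto
qed

lemma sum_columns: "(\<Sum>y\<in>Y. \<Sum>x\<in>R\<inverse> `` {y}. f x y) = (\<Sum>(x, y)\<in>R. f x y)"
proof -
  have "(\<Sum>y\<in>Y. \<Sum>x\<in>R\<inverse> `` {y}. f x y) = (\<Sum>(y, x)\<in>R\<inverse>. f x y)"
    using bigraph.sum_rows[OF bigraph_converse, of "\<lambda>y x. f x y"] .
  also have "\<dots> = (\<Sum>(x, y)\<in>R. f x y)"
    by (rule sum.reindex_bij_witness[of _ "\<lambda>(x, y). (y, x)" "\<lambda>(x, y). (y, x)"]) auto
  finally show ?thesis .
qed

lemma card_columns: "(\<Sum>y\<in>Y. card (R\<inverse> `` {y})) = card R"
  using sum_columns[of "\<lambda>_ _. 1::nat"] by (simp add: split_beta)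

definition edge_form :: "real \<Rightarrow> ('a \<Rightarrow> real) \<Rightarrow> 'a \<times> 'a \<Rightarrow> real" where
  "edge_form c z p = 2 * z (fst p) * z (snd p) + c * (z (fst p))\<^sup>2 + c * (z (snd p))\<^sup>2"

lemma qform_bip: "qform c G z = (\<Sum>p\<in>R. edge_form c z p)"
proof -
  have "qform c G z = (\<Sum>x\<in>X. z x * act c G z x) + (\<Sum>y\<in>Y. z y * act c G z y)"
    using finX finY disj by (simp add: qform_def sum.union_disjoint)
  also have "(\<Sum>x\<in>X. z x * act c G z x) = (\<Sum>(x, y)\<in>R. z x * (z y + c * z x))"
    unfolding sum_rows[symmetric]
    by (intro sum.cong refl) (simp only: act_def nbrs_bipX sum_distrib_left)
  also have "(\<Sum>y\<in>Y. z y * act c G z y) = (\<Sum>(x, y)\<in>R. z y * (z x + c * z y))"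
    unfolding sum_columns[symmetric]
    by (intro sum.cong refl) (simp only: act_def nbrs_bipY sum_distrib_left)
  also have "(\<Sum>(x, y)\<in>R. z x * (z y + c * z x)) + (\<Sum>(x, y)\<in>R. z y * (z x + c * z y))
      = (\<Sum>p\<in>R. edge_form c z p)"
    unfolding sum.distrib[symmetric]
    by (intro sum.cong refl) (auto simp: edge_form_def power2_eq_square algebra_simps)
  finally show ?thesis .
qed

text \<open>Cauchy-Schwarz at each \<open>y\<close> bounds the square of the neighbour sum by the degree of \<open>y\<close>
  times the mass on \<open>X\<close>; the degrees over \<open>Y\<close> add up to the number of edges. Adding the same
  inequality with the sides exchanged bounds the squared eigenvalue by the number of edges.\<close>
lemma adjacency_eigenvector_half:
  assumes ev: "\<And>y. y \<in> Y \<Longrightarrow> act 0 G z y = e * z y"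
  shows "e\<^sup>2 * (\<Sum>y\<in>Y. (z y)\<^sup>2) \<le> real (card R) * (\<Sum>x\<in>X. (z x)\<^sup>2)"
proof -
  have "(e * z y)\<^sup>2 \<le> real (card (R\<inverse> `` {y})) * (\<Sum>x\<in>X. (z x)\<^sup>2)" if y: "y \<in> Y" for y
  proof -
    have "(e * z y)\<^sup>2 = (\<Sum>x\<in>R\<inverse> `` {y}. 1 * z x)\<^sup>2"
      unfolding ev[OF y, symmetric] by (simp add: act_def nbrs_bipY[OF y])
    also have "\<dots> \<le> (\<Sum>x\<in>R\<inverse> `` {y}. 1\<^sup>2) * (\<Sum>x\<in>R\<inverse> `` {y}. (z x)\<^sup>2)"
      by (rule Cauchy_Schwarz_ineq_sum)
    also have "\<dots> \<le> real (card (R\<inverse> `` {y})) * (\<Sum>x\<in>X. (z x)\<^sup>2)"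
      using nbrY(1) finX by (auto intro!: mult_left_mono sum_mono2)
    finally show ?thesis .
  qed
  then have "(\<Sum>y\<in>Y. (e * z y)\<^sup>2) \<le> (\<Sum>y\<in>Y. real (card (R\<inverse> `` {y})) * (\<Sum>x\<in>X. (z x)\<^sup>2))"
    by (rule sum_mono)
  also have "\<dots> = real (card R) * (\<Sum>x\<in>X. (z x)\<^sup>2)"
    by (simp add: sum_distrib_right[symmetric] card_columns[symmetric])
  finally show ?thesis by (simp add: power_mult_distrib sum_distrib_left)
qed

lemma adjacency_upper_bound:
  assumes n: "0 < n"
  shows "(lam 0 G)\<^sup>2 \<le> real (card R)"
proof -
  have ne: "verts G \<noteq> {}" using n cardX by auto
  obtain z where z: "sqnorm G z = 1" and ev: "\<And>v. v \<in> verts G \<Longrightarrow> act 0 G z v = lam 0 G * z v"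
    using nonneg_top_eigenvector[OF finG ne, of 0] by blast
  interpret c: bigraph Y X "R\<inverse>" n by (rule bigraph_converse)
  have "(lam 0 G)\<^sup>2 * (\<Sum>y\<in>Y. (z y)\<^sup>2) \<le> real (card R) * (\<Sum>x\<in>X. (z x)\<^sup>2)"
    by (rule adjacency_eigenvector_half) (use ev in auto)
  moreover have "(lam 0 G)\<^sup>2 * (\<Sum>x\<in>X. (z x)\<^sup>2) \<le> real (card (R\<inverse>)) * (\<Sum>y\<in>Y. (z y)\<^sup>2)"
    by (rule c.adjacency_eigenvector_half) (use ev in \<open>auto simp: bip_converse\<close>)
  moreover have one: "(\<Sum>x\<in>X. (z x)\<^sup>2) + (\<Sum>y\<in>Y. (z y)\<^sup>2) = 1"
    using z finX finY disj by (simp add: sqnorm_def sum.union_disjoint)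
  moreover have "card (R\<inverse>) = card R" by simp
  ultimately have "(lam 0 G)\<^sup>2 * (\<Sum>x\<in>X. (z x)\<^sup>2) + (lam 0 G)\<^sup>2 * (\<Sum>y\<in>Y. (z y)\<^sup>2)
      \<le> real (card R) * (\<Sum>x\<in>X. (z x)\<^sup>2) + real (card R) * (\<Sum>y\<in>Y. (z y)\<^sup>2)"
    by simp
  then show ?thesis unfolding distrib_left[symmetric] one by simp
qed

text \<open>Let \<open>u\<close> maximise the ratio of \<open>z\<close> to the degree. The eigenvalue equation at \<open>u\<close> then gives
  \<open>e \<le> d + D / d\<close>, where \<open>d\<close> is the degree of \<open>u\<close> and \<open>D\<close> the sum of the degrees of its
  neighbours. Since \<open>D\<close> is at most the number of edges and at most \<open>d n\<close>, the right-hand side is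
  at most \<open>card R / n + n\<close>: use the second bound for small \<open>d\<close> and the first for large \<open>d\<close>.\<close>
lemma signless_bound_at_peak:
  assumes n: "0 < n" and u: "u \<in> X" "0 < z u" "R `` {u} \<noteq> {}"
    and ev: "act 1 G z u = e * z u"
    and peak: "\<And>y. y \<in> Y \<Longrightarrow> z y * real (card (R `` {u})) \<le> z u * real (card (R\<inverse> `` {y}))"
  shows "e * real n \<le> real (card R) + (real n)\<^sup>2"
proof -
  define d where "d = real (card (R `` {u}))"
  define D where "D = (\<Sum>y\<in>R `` {u}. real (card (R\<inverse> `` {y})))"
  have d: "0 < d" "d \<le> real n" using u nbrX[of u] by (simp_all add: d_def card_gt_0_iff)
  have "D \<le> (\<Sum>y\<in>Y. real (card (R\<inverse> `` {y})))" unfolding D_def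
    using nbrX(1) finY by (intro sum_mono2) auto
  also have "\<dots> = real (card R)" by (simp add: card_columns[symmetric])
  finally have D1: "D \<le> real (card R)" .
  have "D \<le> (\<Sum>y\<in>R `` {u}. real n)" unfolding D_def using nbrY by (intro sum_mono) simp
  then have D2: "D \<le> d * real n" by (simp add: d_def)
  have "e * z u = (\<Sum>y\<in>R `` {u}. z y) + d * z u"
    unfolding ev[symmetric] by (simp add: act_def nbrs_bipX[OF u(1)] sum.distrib d_def)
  then have "e * z u * d = (\<Sum>y\<in>R `` {u}. z y * d) + d * d * z u"
    by (simp only: sum_distrib_right[symmetric]) (simp add: algebra_simps)
  also have "(\<Sum>y\<in>R `` {u}. z y * d) \<le> (\<Sum>y\<in>R `` {u}. z u * real (card (R\<inverse> `` {y})))"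
    using peak nbrX(1) unfolding d_def by (intro sum_mono) blast
  also have "\<dots> = z u * D" by (simp add: D_def sum_distrib_left)
  finally have "z u * (e * d) \<le> z u * (D + d * d)" by (simp add: algebra_simps)
  then have ed: "e * d \<le> D + d * d" using u(2) by simp
  show ?thesis
  proof (cases "d * real n \<le> real (card R)")
    case True
    have "e * d \<le> d * (real n + d)" using ed D2 by (simp add: algebra_simps)
    then have "e \<le> real n + d" using d by simp
    then have "e * real n \<le> (real n + d) * real n" by (intro mult_right_mono) auto
    then show ?thesis using True by (simp add: algebra_simps power2_eq_square)
  next
    case False
    have "e * real n * d \<le> real n * (D + d * d)" using ed mult_left_mono[OF ed, of "real n"] by (simp add: algebra_simps)
    also have "\<dots> \<le> real n * (real (card R) + d * d)" using D1 by (intro mult_left_mono) auto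
    also have "\<dots> \<le> (real (card R) + (real n)\<^sup>2) * d"
    proof -
      have "0 \<le> (real n - d) * (d * real n - real (card R))"
        using False d by (intro mult_nonneg_nonneg) auto
      then show ?thesis by (simp add: algebra_simps power2_eq_square)
    qed
    finally show ?thesis using d by simp
  qed
qed

lemma signless_upper_bound:
  assumes n: "0 < n" and degX: "\<And>x. x \<in> X \<Longrightarrow> R `` {x} \<noteq> {}"
    and degY: "\<And>y. y \<in> Y \<Longrightarrow> R\<inverse> `` {y} \<noteq> {}"
  shows "lam 1 G * real n \<le> real (card R) + (real n)\<^sup>2"
proof -
  have ne: "verts G \<noteq> {}" using n cardX by auto
  obtain z where z: "\<And>v. 0 \<le> z v" "sqnorm G z = 1"
      and ev: "\<And>v. v \<in> verts G \<Longrightarrow> act 1 G z v = lam 1 G * z v"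
    using nonneg_top_eigenvector[OF finG ne, of 1] by blast
  interpret c: bigraph Y X "R\<inverse>" n by (rule bigraph_converse)
  define d where "d v = real (card (nbrs G v))" for v
  have d: "0 < d v" if "v \<in> X \<union> Y" for v
    using that degX degY nbrX(2) nbrY(2)
    by (auto simp: d_def nbrs_bipX nbrs_bipY card_gt_0_iff)
  obtain u where u: "u \<in> X \<union> Y" "\<And>v. v \<in> X \<union> Y \<Longrightarrow> z v / d v \<le> z u / d u"
  proof -
    have "finite ((\<lambda>v. z v / d v) ` (X \<union> Y))" "(\<lambda>v. z v / d v) ` (X \<union> Y) \<noteq> {}"
      using finG ne by auto
    note Max_in[OF this] Max_ge[OF this(1)]
    then obtain u where u: "u \<in> X \<union> Y" "Max ((\<lambda>v. z v / d v) ` (X \<union> Y)) = z u / d u" by auto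
    have "z v / d v \<le> z u / d u" if "v \<in> X \<union> Y" for v
      unfolding u(2)[symmetric] using that finX finY by (intro Max_ge) auto
    then show thesis using that u(1) by blast
  qed
  obtain v where v: "v \<in> X \<union> Y" "z v \<noteq> 0"
  proof (rule ccontr)
    assume "\<not> thesis"
    then have "\<forall>v\<in>X \<union> Y. z v = 0" using that by blast
    then show False using z(2) by (simp add: sqnorm_def)
  qed
  have "0 < z v / d v" using v z(1)[of v] d[OF v(1)] by simp
  then have "0 < z u / d u" using u(2)[OF v(1)] by linarith
  then have zu: "0 < z u" using d[OF u(1)] by (simp add: zero_less_divide_iff)
  have peak: "z v * d u \<le> z u * d v" if "v \<in> X \<union> Y" for v
    using u(2)[OF that] d[OF that] d[OF u(1)] by (simp add: field_simps)
  show ?thesis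
  proof (cases "u \<in> X")
    case True
    have "z y * real (card (R `` {u})) \<le> z u * real (card (R\<inverse> `` {y}))" if "y \<in> Y" for y
      using peak[of y] that True by (simp add: d_def nbrs_bipX nbrs_bipY)
    then show ?thesis
      by (intro signless_bound_at_peak[where u = u and z = z, OF n True zu degX[OF True] ev]) (use True in auto)
  next
    case False
    then have uY: "u \<in> Y" using u by auto
    have "z x * real (card (R\<inverse> `` {u})) \<le> z u * real (card ((R\<inverse>)\<inverse> `` {x}))" if "x \<in> X" for x
      using peak[of x] that uY by (simp add: d_def nbrs_bipX nbrs_bipY)
    then have "lam 1 G * real n \<le> real (card (R\<inverse>)) + (real n)\<^sup>2"
      by (intro c.signless_bound_at_peak[where u = u and z = z, OF n uY zu degY[OF uY]])
         (use ev uY in \<open>auto simp: bip_converse\<close>)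
    then show ?thesis by simp
  qed
qed

text \<open>The test function is \<open>a\<close> on \<open>A\<close>, \<open>b\<close> on \<open>Y\<close> and zero elsewhere; all edges other than those
  between \<open>A\<close> and \<open>Y\<close> contribute nonnegatively.\<close>
lemma near_complete_lower_bound:
  assumes n: "0 < n" and c: "0 \<le> c" and A: "A \<subseteq> X"
    and sub: "A \<times> Y - {e} \<subseteq> R" and e: "e \<in> A \<times> Y" and ab: "0 \<le> a" "0 \<le> b"
  shows "(real (card A * n) - 1) * (2 * a * b + c * a\<^sup>2 + c * b\<^sup>2)
    \<le> lam c G * (real (card A) * a\<^sup>2 + real n * b\<^sup>2)"
proof -
  have ne: "verts G \<noteq> {}" using n cardX by auto
  define z where "z v = (if v \<in> Y then b else if v \<in> A then a else 0)" for v
  have AY: "A \<inter> Y = {}" "finite A" using A disj finX finite_subset by auto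
  have nonneg: "0 \<le> edge_form c z p" for p
    using c ab by (auto simp: edge_form_def z_def)
  have val: "edge_form c z p = 2 * a * b + c * a\<^sup>2 + c * b\<^sup>2" if "p \<in> A \<times> Y" for p
    using that AY by (auto simp: edge_form_def z_def)
  have "(\<Sum>p\<in>A \<times> Y - {e}. edge_form c z p) = real (card (A \<times> Y - {e})) * (2 * a * b + c * a\<^sup>2 + c * b\<^sup>2)"
    using val by simp
  moreover have "real (card (A \<times> Y - {e})) = real (card A * n) - 1"
  proof -
    have "0 < card (A \<times> Y)" using e AY finY by (auto simp: card_gt_0_iff)
    then show ?thesis using e AY finY cardY by (simp add: card_cartesian_product of_nat_diff)
  qed
  moreover have "(\<Sum>p\<in>A \<times> Y - {e}. edge_form c z p) \<le> qform c G z"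
    unfolding qform_bip using sub finR nonneg by (intro sum_mono2) auto
  moreover have "qform c G z \<le> lam c G * sqnorm G z" by (rule lam_upper[OF finG ne])
  moreover have "sqnorm G z = real (card A) * a\<^sup>2 + real n * b\<^sup>2"
  proof -
    have "sqnorm G z = (\<Sum>v\<in>X. (z v)\<^sup>2) + (\<Sum>v\<in>Y. (z v)\<^sup>2)"
      using finX finY disj by (simp add: sqnorm_def sum.union_disjoint)
    also have "(\<Sum>v\<in>X. (z v)\<^sup>2) = (\<Sum>v\<in>A. (z v)\<^sup>2)"
      using A finX disj by (intro sum.mono_neutral_right) (auto simp: z_def)
    also have "\<dots> = (\<Sum>v\<in>A. a\<^sup>2)" using AY by (intro sum.cong) (auto simp: z_def)
    also have "(\<Sum>v\<in>Y. (z v)\<^sup>2) = real n * b\<^sup>2" by (simp add: z_def cardY)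
    finally show ?thesis by simp
  qed
  ultimately show ?thesis by simp
qed

text \<open>The weights used here and in \<open>near_complete_signless\<close> are the entries of the top
  eigenvectors of the complete bipartite graph on \<open>A\<close> and \<open>Y\<close>.\<close>
lemma near_complete_adjacency:
  assumes n: "0 < n" and A: "A \<subseteq> X" and sub: "A \<times> Y - {e} \<subseteq> R" and e: "e \<in> A \<times> Y"
  shows "0 \<le> lam 0 G" "real (card A * n) - 2 \<le> (lam 0 G)\<^sup>2"
proof -
  define N where "N = real (card A * n)"
  have "0 < card A" using e A finX finite_subset by (fastforce simp: card_gt_0_iff)
  then have "1 \<le> card A * n" using n by simp
  then have N: "1 \<le> N" unfolding N_def by (metis of_nat_1 of_nat_le_iff)
  have "(N - 1) * (2 * sqrt (real n) * sqrt (real (card A))) \<le> lam 0 G * (2 * N)"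
    using near_complete_lower_bound[OF n order_refl A sub e, of "sqrt (real n)" "sqrt (real (card A))"]
    by (simp add: N_def algebra_simps)
  moreover have "sqrt (real n) * sqrt (real (card A)) = sqrt N"
    by (simp add: N_def real_sqrt_mult mult.commute)
  ultimately have "(N - 1) * sqrt N \<le> lam 0 G * N" using N by (simp add: mult.assoc)
  also have "\<dots> = lam 0 G * sqrt N * sqrt N" using N by (simp add: mult.assoc)
  finally have "N - 1 \<le> lam 0 G * sqrt N" using N by simp
  then have l: "0 \<le> lam 0 G * sqrt N" "(N - 1)\<^sup>2 \<le> (lam 0 G * sqrt N)\<^sup>2"
    using N by (auto intro: power_mono)
  show "0 \<le> lam 0 G" using l(1) N by (simp add: zero_le_mult_iff)
  have "(N - 2) * N \<le> (N - 1)\<^sup>2" by (simp add: power2_eq_square algebra_simps)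
  also have "\<dots> \<le> (lam 0 G)\<^sup>2 * N" using l(2) N by (simp add: power_mult_distrib)
  finally show "real (card A * n) - 2 \<le> (lam 0 G)\<^sup>2" using N unfolding N_def[symmetric] by simp
qed

lemma near_complete_signless:
  assumes n: "0 < n" and A: "A \<subseteq> X" and sub: "A \<times> Y - {e} \<subseteq> R" and e: "e \<in> A \<times> Y"
  shows "(real (card A * n) - 1) * real (n + card A) \<le> lam 1 G * real (card A * n)"
proof -
  define m where "m = real (card A)"
  have "(m * n - 1) * (n + m) * (n + m) \<le> lam 1 G * (m * n) * (n + m)"
    using near_complete_lower_bound[OF n _ A sub e, of 1 "real n" m]
    by (simp add: m_def power2_eq_square algebra_simps)
  moreover have "0 < n + m" using n by (simp add: m_def)
  ultimately have "(m * n - 1) * (n + m) \<le> lam 1 G * (m * n)" by simp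
  then show ?thesis by (simp add: m_def)
qed

section \<open>Moving edges\<close>

lemma qform_transfer:
  assumes R': "R' \<subseteq> X \<times> Y" and c: "0 \<le> c" and z: "\<And>v. 0 \<le> z v"
    and f: "inj_on f R" "f ` R \<subseteq> R'" "\<And>p. p \<in> R \<Longrightarrow> edge_form c z p \<le> edge_form c z (f p)"
  shows "qform c G z \<le> qform c (bip X Y R') z"
proof -
  interpret r: bigraph X Y R' n using finX finY disj R' cardX cardY by unfold_locales
  have "qform c G z \<le> (\<Sum>p\<in>R. edge_form c z (f p))"
    unfolding qform_bip by (rule sum_mono[OF f(3)])
  also have "\<dots> = (\<Sum>p\<in>f ` R. edge_form c z p)" by (simp add: sum.reindex[OF f(1)])
  also have "\<dots> \<le> (\<Sum>p\<in>R'. edge_form c z p)"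
    using f(2) r.finR c z by (intro sum_mono2) (auto simp: edge_form_def)
  also have "\<dots> = qform c (bip X Y R') z" by (rule r.qform_bip[symmetric])
  finally show ?thesis .
qed

end

text \<open>If the top eigenvalue of \<open>K\<close> were not larger, then \<open>z\<close> would attain the maximum of the form
  of \<open>K\<close>, hence be an eigenvector of \<open>K\<close> for the same eigenvalue and therefore positive. But at
  \<open>w\<close> the two operators differ by a positive amount.\<close>
lemma lam_strict_increase:
  assumes fin: "finite (verts G)" and ne: "verts G \<noteq> {}" and V: "verts K = verts G"
    and z: "\<And>v. 0 \<le> z v" "sqnorm G z = 1"
      "\<And>v. v \<in> verts G \<Longrightarrow> act c G z v = lam c G * z v"
    and le: "qform c G z \<le> qform c K z" and c: "0 \<le> c"
    and w: "w \<in> verts G" "nbrs G w \<subset> nbrs K w"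
    and pos: "(\<And>v. v \<in> verts K \<Longrightarrow> act c K z v = lam c K * z v) \<Longrightarrow> (\<And>v. v \<in> verts K \<Longrightarrow> 0 < z v)"
  shows "lam c G < lam c K"
proof (rule ccontr)
  assume "\<not> ?thesis"
  then have ge: "lam c K \<le> lam c G" by simp
  have finK: "finite (verts K)" "verts K \<noteq> {}" using fin ne V by auto
  have nK: "sqnorm K z = 1" using z(2) by (simp add: sqnorm_def V)
  have "qform c G z = lam c G" using qform_eigenvector[of G c z, OF z(3)] z(2) by simp
  moreover have "qform c K z \<le> lam c K" using lam_upper[OF finK, of c z] nK by simp
  ultimately have eq: "qform c K z = lam c K * sqnorm K z" "lam c K = lam c G"
    using ge le nK by auto
  have actK: "act c K z v = lam c K * z v" if "v \<in> verts K" for v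
    by (rule lam_eigenvector[OF finK eq(1) that])
  have zpos: "0 < z v" if "v \<in> verts K" for v by (rule pos[OF actK that])
  obtain u where u: "u \<in> nbrs K w - nbrs G w" using w by auto
  have "act c G z w < act c K z w" unfolding act_def
  proof (rule sum_strict_mono2[where b = u])
    show "finite (nbrs K w)" by (rule nbrs_simps(1)[OF finK(1)])
    show "nbrs G w \<subseteq> nbrs K w" using w by auto
    show "u \<in> nbrs K w - nbrs G w" by (rule u)
    have "u \<in> verts K" using u nbrs_simps(2)[of K w] by auto
    then show "0 < z u + c * z w" using zpos z(1)[of w] c by (simp add: add_pos_nonneg)
    show "0 \<le> z x + c * z w" for x using z(1)[of x] z(1)[of w] c by simp
  qed
  then show False using actK[of w] z(3)[OF w(1)] w(1) eq(2) V by simp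
qed

section \<open>The extremal graphs\<close>

text \<open>With \<open>k + 1\<close> vertices in \<open>S\<close> and \<open>k\<close> in \<open>T\<close>, this is the edge set of \<open>F n k\<close>. The letters
  are exchanged with respect to the definition of \<open>Z\<close>: here \<open>S\<close> is part of \<open>X\<close> and corresponds
  to the set of \<open>k + 1\<close> vertices of degree \<open>k\<close>.\<close>
definition block :: "'a set \<Rightarrow> 'a set \<Rightarrow> 'a set \<Rightarrow> 'a set \<Rightarrow> ('a \<times> 'a) set" where
  "block X Y S T = X \<times> Y - S \<times> (Y - T)"

text \<open>A zero of a nonnegative eigenvector forces zeros at all its neighbours. The graph is connected:
  a vertex of \<open>T\<close> is adjacent to all of \<open>X\<close>, and every vertex of \<open>Y\<close> has a neighbour in \<open>X\<close>
  outside \<open>S\<close> since at most one such pair is missing.\<close>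
lemma block_minus_positive:
  assumes sets: "S \<subseteq> X" "T \<subseteq> Y" "X \<inter> Y = {}" "T \<noteq> {}" and fin: "finite X" "finite Y"
    and two: "2 \<le> card (X - S)" and y0: "y0 \<in> Y - T"
    and R: "R = block X Y S T - {(x0, y0)}"
    and z: "\<And>v. 0 \<le> z v" "sqnorm (bip X Y R) z = 1"
    and act: "\<And>v. v \<in> X \<union> Y \<Longrightarrow> act c (bip X Y R) z v = e * z v"
    and v: "v \<in> X \<union> Y"
  shows "0 < z v"
proof (rule ccontr)
  let ?K = "bip X Y R"
  assume "\<not> ?thesis"
  then have zv: "z v = 0" using z(1)[of v] by simp
  have zprop: "z w = 0" if "u \<in> X \<union> Y" "z u = 0" "adj R u w" for u w
  proof -
    have w: "w \<in> nbrs ?K u" using that adj_commute[of R u w] by (auto simp: nbrs_def R block_def adj_def)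
    have "(\<Sum>w\<in>nbrs ?K u. z w) = 0" using act[OF that(1)] that(2) by (simp add: act_def)
    moreover have "finite (nbrs ?K u)" using fin by (intro nbrs_simps) auto
    ultimately show ?thesis using w z(1) by (simp add: sum_nonneg_eq_0_iff)
  qed
  obtain t where t: "t \<in> T" using sets by auto
  have adjt: "adj R x t" "adj R t x" if "x \<in> X" for x
    using that t sets y0 by (auto simp: adj_def R block_def)
  have nx: "\<exists>x\<in>X. adj R x y" if "y \<in> Y" for y
  proof -
    have "card (X - S) \<le> card {x0}" if "X - S \<subseteq> {x0}" using that by (intro card_mono) auto
    then have "\<not> X - S \<subseteq> {x0}" using two by auto
    then obtain x where "x \<in> X - S" "x \<noteq> x0" by auto
    then show ?thesis using that by (auto simp: adj_def R block_def)
  qed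
  obtain x where x: "x \<in> X" "z x = 0"
  proof (cases "v \<in> X")
    case True
    then show thesis using that zv by blast
  next
    case False
    then obtain x where "x \<in> X" "adj R x v" using nx v by auto
    then show thesis using that[of x] zprop[OF v zv, of x] adj_commute[of R] by auto
  qed
  have zt: "z t = 0" using zprop[of x t] x adjt by auto
  have zX: "z x = 0" if "x \<in> X" for x using zprop[of t x] zt adjt that t sets by auto
  have zY: "z y = 0" if y: "y \<in> Y" for y
  proof -
    obtain x where "x \<in> X" "adj R x y" using nx[OF y] by auto
    then show ?thesis using zprop[of x y] zX by auto
  qed
  have "\<forall>v\<in>X \<union> Y. z v = 0" using zX zY by auto
  then have "sqnorm ?K z = 0" by (simp add: sqnorm_def)
  then show False using z(2) by simp
qed

context bigraph
begin

text \<open>Among the proper subgraphs of \<open>block X Y S T\<close> that keep the edges at \<open>S\<close>, those with a single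
  missing pair, outside \<open>T\<close>, are the unique maximisers up to isomorphism. If a pair outside \<open>T\<close>
  is missing, the graph is a proper subgraph of such a maximiser. Otherwise a pair \<open>(x, y)\<close> with
  \<open>y \<in> T\<close> is missing, and \<open>z\<close> decides how to compare \<open>y\<close> with a vertex \<open>y1\<close> outside \<open>T\<close>:
  if \<open>y\<close> weighs at least as much, the edge from \<open>x\<close> to \<open>y1\<close> is moved to \<open>y\<close>; if less, all
  edges from \<open>S\<close> to \<open>y\<close> are moved to \<open>y1\<close>, which takes the place of \<open>y\<close> in \<open>T\<close>.\<close>
lemma missing_edges_decrease_lam:
  assumes S: "S \<subseteq> X" "2 \<le> card (X - S)" and T: "T \<subseteq> Y" "T \<noteq> {}" "T \<noteq> Y"
    and c: "0 \<le> c"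
    and R: "R \<subset> block X Y S T" "S \<times> T \<subseteq> R" and S0: "S \<noteq> {}"
    and notF0: "\<And>x y. x \<in> X - S \<Longrightarrow> y \<in> Y - T \<Longrightarrow> R \<noteq> block X Y S T - {(x, y)}"
  shows "\<exists>T' x y. T' \<subseteq> Y \<and> card T' = card T \<and> x \<in> X - S \<and> y \<in> Y - T' \<and>
    lam c G < lam c (bip X Y (block X Y S T' - {(x, y)}))"
proof -
  have ne: "verts G \<noteq> {}" using S0 S by auto
  obtain z where z0: "\<And>v. 0 \<le> z v" and z1: "sqnorm G z = 1"
    and ev: "\<And>v. v \<in> verts G \<Longrightarrow> act c G z v = lam c G * z v"
    using nonneg_top_eigenvector[OF finG ne, of c] by blast
  have strict: "lam c G < lam c (bip X Y (block X Y S T' - {(x, y)}))"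
    if T': "T' \<subseteq> Y" "T' \<noteq> {}" and xy: "x \<in> X - S" "y \<in> Y - T'"
      and f: "inj_on f R" "f ` R \<subseteq> block X Y S T' - {(x, y)}"
         "\<And>p. p \<in> R \<Longrightarrow> edge_form c z p \<le> edge_form c z (f p)"
      and w: "w \<in> X \<union> Y" "nbrs G w \<subset> nbrs (bip X Y (block X Y S T' - {(x, y)})) w"
    for T' x y f w
  proof (rule lam_strict_increase[OF finG ne _ z0 z1 ev _ c _ w(2)])
    let ?R = "block X Y S T' - {(x, y)}"
    show "verts (bip X Y ?R) = verts G" by simp
    show "qform c G z \<le> qform c (bip X Y ?R) z"
      by (rule qform_transfer[OF _ c z0 f]) (auto simp: block_def)
    show "w \<in> verts G" using w by simp
    fix v assume "\<And>v. v \<in> verts (bip X Y ?R) \<Longrightarrow> act c (bip X Y ?R) z v = lam c (bip X Y ?R) * z v"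
      "v \<in> verts (bip X Y ?R)"
    then show "0 < z v"
      using z0 z1 by (intro block_minus_positive[OF S(1) T'(1) disj T'(2) finX finY S(2) xy(2) refl])
        (auto simp: sqnorm_def)
  qed auto
  show ?thesis
  proof (cases "\<exists>x y. (x, y) \<in> block X Y S T - R \<and> y \<notin> T")
    case True
    then obtain x y where xy: "(x, y) \<in> block X Y S T - R" "y \<notin> T" by blast
    then have mem: "x \<in> X - S" "y \<in> Y - T" by (auto simp: block_def)
    let ?R = "block X Y S T - {(x, y)}"
    have "R \<subset> ?R" using notF0[OF mem] R xy by auto
    then obtain x' y' where xy': "(x', y') \<in> ?R - R" by auto
    interpret r: bigraph X Y ?R n
      using finX finY disj cardX cardY by unfold_locales (auto simp: block_def)
    have x': "x' \<in> X" using xy' by (auto simp: block_def)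
    have "lam c G < lam c (bip X Y ?R)"
    proof (rule strict[OF T(1,2) mem, of id x'])
      show "nbrs G x' \<subset> nbrs (bip X Y ?R) x'"
        unfolding nbrs_bipX[OF x'] r.nbrs_bipX[OF x'] using \<open>R \<subset> ?R\<close> xy' by auto
    qed (use x' \<open>R \<subset> ?R\<close> in auto)
    then show ?thesis using T mem by blast
  next
    case False
    obtain x y where xy: "(x, y) \<in> block X Y S T - R" using R by auto
    have y: "y \<in> T" using False xy by blast
    have x: "x \<in> X - S" using xy y R(2) by (auto simp: block_def)
    obtain y1 where y1: "y1 \<in> Y - T" using T by auto
    have y1S: "(s, y1) \<notin> R" if "s \<in> S" for s using R(1) y1 that by (auto simp: block_def)
    show ?thesis
    proof (cases "z y1 \<le> z y")
      case True
      let ?R = "block X Y S T - {(x, y1)}"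
      let ?f = "\<lambda>p. if p = (x, y1) then (x, y) else p"
      interpret r: bigraph X Y ?R n
        using finX finY disj cardX cardY by unfold_locales (auto simp: block_def)
      have yY: "y \<in> Y" using y T by auto
      have "lam c G < lam c (bip X Y ?R)"
      proof (rule strict[OF T(1,2) x y1, of ?f y])
        show "inj_on ?f R" using xy by (auto simp: inj_on_def)
        show "?f ` R \<subseteq> ?R" using R xy y y1 by auto
        show "edge_form c z p \<le> edge_form c z (?f p)" for p
          using True z0[of y1] z0[of x] c
          by (auto simp: edge_form_def intro!: add_mono mult_left_mono power_mono)
        show "nbrs G y \<subset> nbrs (bip X Y ?R) y"
          unfolding nbrs_bipY[OF yY] r.nbrs_bipY[OF yY]
          using R(1) xy y y1 by (auto simp: block_def)
      qed (use yY in auto)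
      then show ?thesis using T x y1 by blast
    next
      case False
      let ?T = "insert y1 (T - {y})"
      let ?R = "block X Y S ?T - {(x, y)}"
      let ?f = "\<lambda>(a, b). if a \<in> S \<and> b = y then (a, y1) else (a, b)"
      interpret r: bigraph X Y ?R n
        using finX finY disj cardX cardY by unfold_locales (auto simp: block_def)
      have T': "?T \<subseteq> Y" "?T \<noteq> {}" "y \<in> Y - ?T" "y1 \<in> Y" using T y y1 by auto
      obtain s where s: "s \<in> S" using S0 by auto
      have "lam c G < lam c (bip X Y ?R)"
      proof (rule strict[OF T'(1,2) x T'(3), of ?f y1])
        show "inj_on ?f R" using y1S by (auto simp: inj_on_def split: if_splits)
        show "?f ` R \<subseteq> ?R"
          using R(1) xy x y T' by (auto simp: block_def split: if_splits)
        show "edge_form c z p \<le> edge_form c z (?f p)" for p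
          using False z0[of y] z0[of "fst p"] c
          by (auto simp: edge_form_def split_beta intro!: add_mono mult_left_mono power_mono)
        show "nbrs G y1 \<subset> nbrs (bip X Y ?R) y1"
        proof
          show "nbrs G y1 \<subseteq> nbrs (bip X Y ?R) y1"
            unfolding nbrs_bipY[OF T'(4)] r.nbrs_bipY[OF T'(4)]
            using R(1) y y1 by (auto simp: block_def)
          have "s \<in> nbrs (bip X Y ?R) y1" "s \<notin> nbrs G y1"
            unfolding nbrs_bipY[OF T'(4)] r.nbrs_bipY[OF T'(4)]
            using s y1S[OF s] S(1) x y y1 by (auto simp: block_def)
          then show "nbrs G y1 \<noteq> nbrs (bip X Y ?R) y1" by blast
        qed
      qed (use T' in auto)
      moreover have "card ?T = card T"
      proof -
        have "finite T" using T finY finite_subset by blast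
        then have "card ?T = Suc (card (T - {y}))" using y1 by simp
        then show ?thesis using card_Suc_Diff1[OF \<open>finite T\<close> y] by simp
      qed
      ultimately show ?thesis using T' x by blast
    qed
  qed
qed

end

lemma bij_betw_three_blocks:
  assumes fin: "finite P" "finite Q" "finite W" and dj: "P \<inter> Q = {}" "P \<inter> W = {}" "Q \<inter> W = {}"
  obtains g where "bij_betw g (P \<union> Q \<union> W) {..<card P + card Q + card W}"
    "\<And>v. v \<in> P \<Longrightarrow> g v < card P"
    "\<And>v. v \<in> Q \<Longrightarrow> card P \<le> g v \<and> g v < card P + card Q"
    "\<And>v. v \<in> W \<Longrightarrow> card P + card Q \<le> g v"
proof -
  let ?p = "card P" and ?q = "card Q" and ?w = "card W"
  obtain f where f: "bij_betw f P {..<?p}"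
    using finite_same_card_bij[of P "{..<?p}"] fin by auto
  obtain g where g: "bij_betw g Q {?p..<?p + ?q}"
    using finite_same_card_bij[of Q "{?p..<?p + ?q}"] fin by auto
  obtain h where h: "bij_betw h W {?p + ?q..<?p + ?q + ?w}"
    using finite_same_card_bij[of W "{?p + ?q..<?p + ?q + ?w}"] fin by auto
  let ?k = "\<lambda>v. if v \<in> P \<union> Q then if v \<in> P then f v else g v else h v"
  have fg: "bij_betw (\<lambda>v. if v \<in> P then f v else g v) (P \<union> Q) ({..<?p} \<union> {?p..<?p + ?q})"
    by (rule bij_betw_disjoint_Un[OF f g dj(1)]) auto
  have "bij_betw ?k (P \<union> Q \<union> W) ({..<?p} \<union> {?p..<?p + ?q} \<union> {?p + ?q..<?p + ?q + ?w})"
    by (rule bij_betw_disjoint_Un[OF fg h]) (use dj in auto)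
  moreover have "{..<?p} \<union> {?p..<?p + ?q} \<union> {?p + ?q..<?p + ?q + ?w} = {..<?p + ?q + ?w}" by auto
  ultimately have k: "bij_betw ?k (P \<union> Q \<union> W) {..<?p + ?q + ?w}" by simp
  show thesis
  proof (rule that[OF k])
    show "?k v < ?p" if "v \<in> P" for v using bij_betwE[OF f] that by auto
    show "?p \<le> ?k v \<and> ?k v < ?p + ?q" if "v \<in> Q" for v
      using bij_betwE[OF g] that dj by auto
    show "?p + ?q \<le> ?k v" if "v \<in> W" for v
      using bij_betwE[OF h] that dj by auto
  qed
qed

lemma verts_F: "verts (F n k) = Inl ` {..<n} \<union> Inr ` {..<n}"
    "verts (F0 n k) = Inl ` {..<n} \<union> Inr ` {..<n}" if "k < n"
  using that by (simp_all add: F_def F0_def Z_def Z0_def)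

lemma edges_F:
  assumes "k < n"
  shows "{Inl i, Inr j} \<in> edges (F n k) \<longleftrightarrow> i < n \<and> j < n \<and> \<not> (i < n - k \<and> j < k + 1)"
    "{Inl i, Inr j} \<in> edges (F0 n k) \<longleftrightarrow>
       i < n \<and> j < n \<and> \<not> (i < n - k \<and> j < k + 1) \<and> \<not> (i = 0 \<and> j = k + 1)"
    "{Inl i, Inl i'} \<notin> edges (F n k)" "{Inr j, Inr j'} \<notin> edges (F n k)"
    "{Inl i, Inl i'} \<notin> edges (F0 n k)" "{Inr j, Inr j'} \<notin> edges (F0 n k)"
  using assms by (auto simp: F_def F0_def Z_def Z0_def doubleton_eq_iff)

context bigraph
begin

text \<open>The enumeration of \<open>X\<close> lists \<open>S\<close> first and then \<open>x0\<close>; that of \<open>Y\<close> starts with \<open>y0\<close> and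
  lists \<open>T\<close> last. This matches the deleted edge with the one in the definition of \<open>Z0\<close>.\<close>
lemma block_iso:
  assumes S: "S \<subseteq> X" "card S = k + 1" and T: "T \<subseteq> Y" "card T = k"
    and x0: "x0 \<in> X - S" and y0: "y0 \<in> Y - T"
  shows "graph_iso (bip X Y (block X Y S T)) (F n k)"
    "graph_iso (bip X Y (block X Y S T - {(x0, y0)})) (F0 n k)"
proof -
  have fin: "finite S" "finite T" using S T finX finY finite_subset by blast+
  have "card S < n"
    using psubset_card_mono[OF finX, of S] S(1) x0 cardX by auto
  then have kn: "k + 1 < n" using S(2) by simp
  obtain g where g: "bij_betw g (S \<union> {x0} \<union> (X - S - {x0})) {..<card S + card {x0} + card (X - S - {x0})}"
    "\<And>v. v \<in> S \<Longrightarrow> g v < card S"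
    "\<And>v. v \<in> {x0} \<Longrightarrow> card S \<le> g v \<and> g v < card S + card {x0}"
    "\<And>v. v \<in> X - S - {x0} \<Longrightarrow> card S + card {x0} \<le> g v"
    using bij_betw_three_blocks[of S "{x0}" "X - S - {x0}"] fin finX x0 by auto
  obtain h where h: "bij_betw h ({y0} \<union> (Y - T - {y0}) \<union> T) {..<card {y0} + card (Y - T - {y0}) + card T}"
    "\<And>v. v \<in> {y0} \<Longrightarrow> h v < card {y0}"
    "\<And>v. v \<in> Y - T - {y0} \<Longrightarrow> card {y0} \<le> h v \<and> h v < card {y0} + card (Y - T - {y0})"
    "\<And>v. v \<in> T \<Longrightarrow> card {y0} + card (Y - T - {y0}) \<le> h v"
    using bij_betw_three_blocks[of "{y0}" "Y - T - {y0}" T] fin finY y0 by auto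
  have cX: "card (X - S - {x0}) = n - k - 2" using S x0 finX fin cardX by (simp add: card_Diff_subset)
  have cY: "card (Y - T - {y0}) = n - k - 1" using T y0 finY fin cardY by (simp add: card_Diff_subset)
  have eX: "S \<union> {x0} \<union> (X - S - {x0}) = X" and eY: "{y0} \<union> (Y - T - {y0}) \<union> T = Y"
    using S x0 T y0 by auto
  have "card S + card {x0} + card (X - S - {x0}) = n" "card {y0} + card (Y - T - {y0}) + card T = n"
    using S(2) T(2) cX cY kn by auto
  then have gX: "bij_betw g X {..<n}" and hY: "bij_betw h Y {..<n}"
    using g(1) h(1) unfolding eX eY by simp_all
  have gb: "g v < n" if "v \<in> X" for v using bij_betwE[OF gX] that by auto
  have hb: "h v < n" if "v \<in> Y" for v using bij_betwE[OF hY] that by auto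
  have gS: "g v < k + 1 \<longleftrightarrow> v \<in> S" if "v \<in> X" for v
    using g(2-4)[of v] that S(2) by (cases "v \<in> S"; cases "v = x0") auto
  have g0: "g v = k + 1 \<longleftrightarrow> v = x0" if "v \<in> X" for v
    using g(2-4)[of v] that S(2) by (cases "v \<in> S"; cases "v = x0") auto
  have hT: "h v < n - k \<longleftrightarrow> v \<notin> T" if "v \<in> Y" for v
    using h(2-4)[of v] that cY kn by (cases "v \<in> T"; cases "v = y0") auto
  have h0: "h v = 0 \<longleftrightarrow> v = y0" if "v \<in> Y" for v
    using h(2-4)[of v] that cY kn by (cases "v \<in> T"; cases "v = y0") auto
  define f where "f v = (if v \<in> X then Inr (g v) else Inl (h v))" for v
  have fX: "f v = Inr (g v)" if "v \<in> X" for v using that by (simp add: f_def)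
  have fY: "f v = Inl (h v)" if "v \<in> Y" for v using that disj by (auto simp: f_def)
  have "bij_betw f (X \<union> Y) (Inr ` {..<n} \<union> Inl ` {..<n})"
  proof -
    have "bij_betw (\<lambda>v. Inr (g v)) X (Inr ` {..<n})" "bij_betw (\<lambda>v. Inl (h v)) Y (Inl ` {..<n})"
      using gX hY by (auto simp: bij_betw_def inj_on_def)
    then show ?thesis unfolding f_def[abs_def]
      using disj by (intro bij_betw_disjoint_Un) auto
  qed
  then have bij: "bij_betw f (X \<union> Y) (Inl ` {..<n} \<union> Inr ` {..<n})" by (simp add: Un_commute)
  have kn': "k < n" using kn by simp
  note E = edges_F[OF kn']
  have F: "adj (block X Y S T) u v \<longleftrightarrow> {f u, f v} \<in> edges (F n k)"
    if "u \<in> X \<union> Y" "v \<in> X \<union> Y" for u v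
    using that disj S(1)
    by (auto simp: fX fY E insert_commute[of "Inr _" "Inl _"] gb hb hT gS[simplified] adj_def block_def)
  have F0: "adj (block X Y S T - {(x0, y0)}) u v \<longleftrightarrow> {f u, f v} \<in> edges (F0 n k)"
    if "u \<in> X \<union> Y" "v \<in> X \<union> Y" for u v
    using that disj S(1) x0 y0
    by (auto simp: fX fY E insert_commute[of "Inr _" "Inl _"] gb hb hT h0 gS[simplified] g0[simplified]
        adj_def block_def)
  show "graph_iso (bip X Y (block X Y S T)) (F n k)"
    unfolding graph_iso_def using bij F by (intro exI[of _ f]) (simp add: verts_F[OF kn'])
  show "graph_iso (bip X Y (block X Y S T - {(x0, y0)})) (F0 n k)"
    unfolding graph_iso_def using bij F0 by (intro exI[of _ f]) (simp add: verts_F[OF kn'])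
qed

lemma lam_F0:
  assumes "S \<subseteq> X" "card S = k + 1" "T \<subseteq> Y" "card T = k" "x \<in> X - S" "y \<in> Y - T"
  shows "lam c (F0 n k) = lam c (bip X Y (block X Y S T - {(x, y)}))"
proof (rule lam_iso[OF block_iso(2)[OF assms], symmetric])
  show "verts (bip X Y (block X Y S T - {(x, y)})) \<noteq> {}" using assms(5) by auto
qed (simp add: finX finY)

text \<open>The degree condition makes the neighbourhood of every vertex of \<open>S\<close> equal to \<open>R `` S\<close>, which
  then has exactly \<open>k\<close> elements, so the graph is a subgraph of the extremal one that differs from
  it only away from \<open>S\<close>.\<close>
lemma deficient_extremal:
  assumes k: "1 \<le> k" and n: "k + 3 \<le> n" and c: "0 \<le> c"
    and S: "S \<subseteq> X" "card S = k + 1" "card (R `` S) \<le> k"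
    and deg: "\<And>x. x \<in> X \<Longrightarrow> k \<le> card (R `` {x})"
    and large: "lam c (F0 n k) \<le> lam c G"
  shows "graph_iso G (F n k) \<or> graph_iso G (F0 n k)"
proof -
  define T where "T = R `` S"
  have T: "T \<subseteq> Y" "finite T" using RXY finY finite_subset[of T Y] by (auto simp: T_def)
  have finS: "finite S" "S \<noteq> {}" using S finX finite_subset by auto
  have row: "R `` {x} = T" if "x \<in> S" for x
  proof (rule card_seteq[OF T(2)])
    show "R `` {x} \<subseteq> T" using that by (auto simp: T_def)
    show "card T \<le> card (R `` {x})" using S deg[of x] that by (auto simp: T_def)
  qed
  obtain s where s: "s \<in> S" using finS by auto
  have cT: "card T = k"
    using S(3) deg[of s] row[OF s] s S(1) by (auto simp: T_def)
  have TY: "T \<noteq> {}" "T \<noteq> Y" using cT k n cardY by auto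
  have cXS: "card (X - S) = n - (k + 1)" using S finS cardX by (simp add: card_Diff_subset)
  have ST: "S \<times> T \<subseteq> R" using row by auto
  have Rb: "R \<subseteq> block X Y S T" using RXY row by (auto simp: block_def)
  have "card (X - S) \<noteq> 0" using cXS n by simp
  then obtain x0 where x0: "x0 \<in> X - S" by (metis card.empty ex_in_conv)
  obtain y0 where y0: "y0 \<in> Y - T" using T TY by auto
  show ?thesis
  proof (cases "R = block X Y S T")
    case True
    then show ?thesis using block_iso(1)[OF S(1,2) T(1) cT x0 y0] by simp
  next
    case False
    show ?thesis
    proof (cases "\<exists>x\<in>X - S. \<exists>y\<in>Y - T. R = block X Y S T - {(x, y)}")
      case True
      then obtain x y where xy: "x \<in> X - S" "y \<in> Y - T" "R = block X Y S T - {(x, y)}" by blast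
      show ?thesis using block_iso(2)[OF S(1,2) T(1) cT xy(1,2)] xy(3) by simp
    next
      case nF0: False
      have two: "2 \<le> card (X - S)" using cXS n by simp
      obtain T' x y where T': "T' \<subseteq> Y" "card T' = card T" "x \<in> X - S" "y \<in> Y - T'"
        "lam c G < lam c (bip X Y (block X Y S T' - {(x, y)}))"
        using missing_edges_decrease_lam[OF S(1) two T(1) TY c _ ST finS(2)] Rb False nF0 by blast
      then show ?thesis using lam_F0[OF S(1,2) T'(1) _ T'(3,4), of c] cT large by simp
    qed
  qed
qed

text \<open>With \<open>m = n - k - 1\<close>, both spectral hypotheses give \<open>card R \<ge> m n - 2\<close>. The loss of two is
  caused by the edge missing from the complete bipartite graph in the extremal graph.\<close>
lemma few_missing_edges:
  assumes k: "k + 1 < n" and half: "2 * (k + 1) < n"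
    and degX: "\<And>x. x \<in> X \<Longrightarrow> R `` {x} \<noteq> {}"
    and degY: "\<And>y. y \<in> Y \<Longrightarrow> R\<inverse> `` {y} \<noteq> {}"
    and c: "c = 0 \<or> c = 1" and large: "lam c (F0 n k) \<le> lam c G"
  shows "card (X \<times> Y - R) \<le> n * (k + 1) + 2"
proof -
  have n: "0 < n" using k by simp
  obtain S where S: "S \<subseteq> X" "card S = k + 1" "finite S"
    using obtain_subset_with_card_n[of "k + 1" X] k cardX by auto
  obtain T where T: "T \<subseteq> Y" "card T = k" "finite T"
    using obtain_subset_with_card_n[of k Y] k cardY by auto
  define m where "m = card (X - S)"
  have m: "m = n - (k + 1)" "0 < m" "n < 2 * m"
    using S cardX k half by (simp_all add: m_def card_Diff_subset)
  obtain x0 where x0: "x0 \<in> X - S" using m(2) by (metis card.empty ex_in_conv less_irrefl m_def)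
  have "card (Y - T) \<noteq> 0" using T cardY k by (simp add: card_Diff_subset)
  then obtain y0 where y0: "y0 \<in> Y - T" by (metis card.empty ex_in_conv)
  let ?K = "block X Y S T - {(x0, y0)}"
  interpret K: bigraph X Y ?K n
    using finX finY disj cardX cardY by unfold_locales (auto simp: block_def)
  have sub: "(X - S) \<times> Y - {(x0, y0)} \<subseteq> ?K" "(x0, y0) \<in> (X - S) \<times> Y" "X - S \<subseteq> X"
    using x0 y0 by (auto simp: block_def)
  have lam: "lam c (bip X Y ?K) \<le> lam c G"
    using large lam_F0[OF S(1,2) T(1,2) x0 y0, of c] by simp
  have "real m * real n - 3 < real (card R)"
    using c
  proof
    assume c0: "c = 0"
    note b = K.near_complete_adjacency[OF n sub(3,1,2), folded m_def]
    have "real (m * n) - 2 \<le> (lam 0 (bip X Y ?K))\<^sup>2" by (rule b(2))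
    also have "\<dots> \<le> (lam 0 G)\<^sup>2" using lam b(1) c0 by (intro power_mono) auto
    also have "\<dots> \<le> real (card R)" by (rule adjacency_upper_bound[OF n])
    finally show ?thesis by simp
  next
    assume c1: "c = 1"
    have "(real (m * n) - 1) * real (n + m) \<le> lam 1 (bip X Y ?K) * real (m * n)"
      using K.near_complete_signless[OF n sub(3,1,2)] by (simp add: m_def)
    also have "\<dots> \<le> lam 1 G * real (m * n)" using lam c1 by (intro mult_right_mono) auto
    also have "\<dots> = real m * (lam 1 G * real n)" by simp
    also have "\<dots> \<le> real m * (real (card R) + (real n)\<^sup>2)"
      using signless_upper_bound[OF n degX degY] by (intro mult_left_mono) auto
    finally have "real m * (real m * real n - 3) + (2 * real m - real n) \<le> real m * real (card R)"
      by (simp add: algebra_simps power2_eq_square)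
    moreover have "0 < 2 * real m - real n" using m(3) by linarith
    ultimately have "real m * (real m * real n - 3) < real m * real (card R)" by linarith
    then show ?thesis using m(2) by simp
  qed
  then have "real (m * n) < real (card R + 3)" by simp
  then have e: "m * n \<le> card R + 2" by linarith
  have "card (X \<times> Y - R) = n * n - card R"
    using RXY finR cardX cardY by (simp add: card_Diff_subset card_cartesian_product)
  moreover have "n * n = m * n + n * (k + 1)"
  proof -
    have "n * n = (m + (k + 1)) * n" using m(1) k by simp
    then show ?thesis by (simp add: algebra_simps)
  qed
  ultimately show ?thesis using e by linarith
qed

end

section \<open>The spectral condition for traceability\<close>

theorem theorem1p16:
  fixes G :: "'a sgraph" and n k :: nat
  assumes "simple_graph G"
    and "balanced_bipartite G"
    and "card (verts G) = 2 * n"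
    and "2 * n \<ge> max (6 * k * (k + 1)) (4 * (k + 2)\<^sup>2)"
    and "min_degree G \<ge> k"
    and "k \<ge> 2"
    and "rho G \<ge> rho (F0 n k) \<or> mu G \<ge> mu (F0 n k)"
  shows "traceable G \<or> graph_iso G (F n k) \<or> graph_iso G (F0 n k)"
proof -
  obtain X Y where XY: "bipartition G X Y" "card X = card Y"
    using assms(2) by (auto simp: balanced_bipartite_def)
  define R where "R = {(x, y). x \<in> X \<and> y \<in> Y \<and> {x, y} \<in> edges G}"
  have G: "G = bip X Y R" unfolding R_def by (rule graph_eq_bip[OF XY(1)])
  have fin: "finite (verts G)" using assms(1) by (simp add: simple_graph_def)
  have V: "X \<union> Y = verts G" "X \<inter> Y = {}" using XY(1) by (auto simp: bipartition_def)
  then have finXY: "finite X" "finite Y" using fin by (metis finite_Un)+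
  have "card X + card Y = 2 * n"
    using assms(3) card_Un_disjoint[OF finXY V(2)] V(1) by simp
  then have cards: "card X = n" "card Y = n" using XY(2) by auto
  interpret b: bigraph X Y R n
    using finXY V cards by unfold_locales (auto simp: R_def)
  interpret c: bigraph Y X "R\<inverse>" n by (rule b.bigraph_converse)
  have n: "2 * (k + 2)\<^sup>2 \<le> n" using assms(4) by simp
  have nk: "2 * (k + 1) < n" "k + 3 \<le> n" "k + 1 < n"
  proof -
    have "2 * (k + 2) + 2 * (k + 2) \<le> 2 * (k + 2)\<^sup>2" by (simp add: power2_eq_square)
    from le_trans[OF this n] have "4 * k + 8 \<le> n" by simp
    then show "2 * (k + 1) < n" "k + 3 \<le> n" "k + 1 < n" by simp_all
  qed
  have deg: "k \<le> card (nbrs G v)" if "v \<in> verts G" for v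
  proof -
    have "min_degree G \<le> degree G v"
      unfolding min_degree_def using fin that by (intro Min_le) auto
    then show ?thesis using assms(5) by (simp add: nbrs_simps(3))
  qed
  have degX: "k \<le> card (R `` {x})" if "x \<in> X" for x
    using deg[of x] that b.nbrs_bipX[OF that] V(1) unfolding G[symmetric] by auto
  have degY: "k \<le> card (R\<inverse> `` {y})" if "y \<in> Y" for y
    using deg[of y] that b.nbrs_bipY[OF that] V(1) unfolding G[symmetric] by auto
  have neX: "R `` {x} \<noteq> {}" if "x \<in> X" for x using degX[OF that] assms(6) by auto
  have neY: "R\<inverse> `` {y} \<noteq> {}" if "y \<in> Y" for y using degY[OF that] assms(6) by auto
  obtain r where r: "r = 0 \<or> r = 1" "lam r (F0 n k) \<le> lam r (bip X Y R)"
    using assms(7) unfolding rho_lam mu_lam G[symmetric] by blast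
  then have r0: "0 \<le> r" by auto
  have k1: "1 \<le> k" using assms(6) by simp
  have miss: "card (X \<times> Y - R) \<le> n * (k + 1) + 2"
    by (rule b.few_missing_edges[OF nk(3,1) neX neY r])
  consider p where "spanning_path (X \<union> Y) R p"
    | S where "S \<subseteq> X" "card S = k + 1" "card (R `` S) \<le> k"
    | S where "S \<subseteq> Y" "card S = k + 1" "card (R\<inverse> `` S) \<le> k"
    using b.dense_traceable_or_deficient[OF assms(6) n degX degY miss] by blast
  then show ?thesis
  proof cases
    case 1
    then have "traceable (bip X Y R)"
      unfolding traceable_def spanning_path_def by auto
    then show ?thesis unfolding G[symmetric] ..
  next
    case 2
    then show ?thesis
      using b.deficient_extremal[OF k1 nk(2) r0 2 degX r(2)] unfolding G[symmetric] by blast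
  next
    case 3
    then show ?thesis
      using c.deficient_extremal[OF k1 nk(2) r0 3 degY] r(2)
      unfolding bip_converse G[symmetric] by blast
  qed
qed

end
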